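(* Let $\epsilon,\mu>0$ be real constants, $\eta=\sqrt{\mu/\epsilon}$, and let $J_z:\mathbb{R}^2\to\mathbb{R}$, $(x,\theta)\mapsto J_z(x,\theta)$, be a real-analytic function (in particular $C^\infty$). Let $\theta_{max}>0$ and $x_{max}>0$, and define $$H_y(x,\theta) = - \sum_{n=0}^{\infty} \frac{\theta^{2n+2}}{(2n+2)!} \sum_{m=0}^{n} \frac{\partial^{2n+1} J_z(x,0)}{\partial\theta^{2(n-m)}\,\partial x^{2m+1}} - \sum_{n=0}^{\infty} \frac{\theta^{2n+3}}{(2n+3)!} \sum_{m=0}^{n} \frac{\partial^{2n+2} J_z(x,0)}{\partial\theta^{2(n-m)+1}\,\partial x^{2m+1}},$$ $$E_z(x,\theta) = - \eta\sum_{n=0}^{\infty} \frac{\theta^{2n+2}}{(2n+2)!} \sum_{m=0}^{n} \frac{\partial^{2n+1} J_z(x,0)}{\partial\theta^{2(n-m)+1}\,\partial x^{2m}} - \eta\sum_{n=0}^{\infty} \frac{\theta^{2n+1}}{(2n+1)!} \sum_{m=0}^{n} \frac{\partial^{2n} J_z(x,0)}{\partial\theta^{2(n-m)}\,\partial x^{2m}}.$$ Suppose that the series in these two formulas converge for all $(x,\theta)$ in the range $0\le\theta\le\theta_{max}$, $0\le|x|\le x_{max}$. Then in this range the pair $\{H_y,E_z\}$ solves the source-driven one-dimensional Maxwell problem with zero initial values: $$\frac{\partial H_y(x,\theta)}{\partial\theta}=\frac{1}{\eta}\frac{\partial E_z(x,\theta)}{\partial x},\qquad \frac{\partial E_z(x,\theta)}{\partial\theta}=\eta\frac{\partial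 H_y(x,\theta)}{\partial x}-\eta J_z(x,\theta),$$ $$H_y(x,0)=0,\qquad E_z(x,0)=0.$$
   Context: Here $x$ is the space variable and $\theta=ct$ is the rescaled time ($t$ is time, $c=1/\sqrt{\epsilon\mu}$). The notation $\frac{\partial^{i+j} J_z(x,0)}{\partial\theta^{i}\,\partial x^{j}}$ means the mixed partial derivative of $J_z$, of order $i$ in $\theta$ and order $j$ in $x$, evaluated at the point $(x,0)$. The functions $H_y,E_z$ are considered on the rectangle $\{(x,\theta):|x|\le x_{max},\,0\le\theta\le\theta_{max}\}$; partial derivatives at boundary points of the rectangle are understood as one-sided. *)

theory Defs
  imports "HOL-Analysis.Analysis"
begin

text \<open>
  Functions of the space variable \<open>x\<close> and the rescaled time \<open>\<theta>\<close> are functions on pairs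
  \<open>(x, \<theta>)\<close>.
\<close>

text \<open>
  Real analyticity on an open set of the plane: near every point, \<open>f\<close> is the sum of a
  convergent double power series. Summation over pairs of exponents is unordered, which for real
  terms is the same as absolute convergence.
\<close>

definition real_analytic2_at :: "(real \<times> real \<Rightarrow> real) \<Rightarrow> real \<times> real \<Rightarrow> bool" where
  "real_analytic2_at f p \<longleftrightarrow>
     (\<exists>(a :: nat \<Rightarrow> nat \<Rightarrow> real) r. r > 0 \<and>
        (\<forall>u v. \<bar>u\<bar> < r \<longrightarrow> \<bar>v\<bar> < r \<longrightarrow>
           ((\<lambda>(i, j). a i j * u ^ i * v ^ j) has_sum f (fst p + u, snd p + v)) UNIV))"

definition real_analytic2_on :: "(real \<times> real \<Rightarrow> real) \<Rightarrow> (real \<times> real) set \<Rightarrow> bool" where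
  "real_analytic2_on f S \<longleftrightarrow> (\<forall>p\<in>S. real_analytic2_at f p)"

text \<open>
  \<open>mixed_partial i j f (x, \<theta>)\<close> has order \<open>i\<close> in \<open>\<theta>\<close> and order \<open>j\<close> in \<open>x\<close>; as in the notation
  \<open>\<partial>\<^sup>i\<^sup>+\<^sup>j f / \<partial>\<theta>\<^sup>i \<partial>x\<^sup>j\<close>, the \<open>x\<close>-derivatives are taken first.
\<close>

definition mixed_partial :: "nat \<Rightarrow> nat \<Rightarrow> (real \<times> real \<Rightarrow> real) \<Rightarrow> real \<times> real \<Rightarrow> real" where
  "mixed_partial i j f p =
     (deriv ^^ i) (\<lambda>\<theta>. (deriv ^^ j) (\<lambda>x. f (x, \<theta>)) (fst p)) (snd p)"

text \<open>
  The terms of the four series. The suffixes refer to the parity of the power of \<open>\<theta>\<close>. Signs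
  and the factor \<open>\<eta>\<close> are attached in \<open>Hy\<close> and \<open>Ez\<close> below.
\<close>

definition Hy_even_term :: "(real \<times> real \<Rightarrow> real) \<Rightarrow> real \<Rightarrow> real \<Rightarrow> nat \<Rightarrow> real" where
  "Hy_even_term J x \<theta> n =
     \<theta> ^ (2 * n + 2) / fact (2 * n + 2) *
       (\<Sum>m=0..n. mixed_partial (2 * (n - m)) (2 * m + 1) J (x, 0))"

definition Hy_odd_term :: "(real \<times> real \<Rightarrow> real) \<Rightarrow> real \<Rightarrow> real \<Rightarrow> nat \<Rightarrow> real" where
  "Hy_odd_term J x \<theta> n =
     \<theta> ^ (2 * n + 3) / fact (2 * n + 3) *
       (\<Sum>m=0..n. mixed_partial (2 * (n - m) + 1) (2 * m + 1) J (x, 0))"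

definition Ez_even_term :: "(real \<times> real \<Rightarrow> real) \<Rightarrow> real \<Rightarrow> real \<Rightarrow> nat \<Rightarrow> real" where
  "Ez_even_term J x \<theta> n =
     \<theta> ^ (2 * n + 2) / fact (2 * n + 2) *
       (\<Sum>m=0..n. mixed_partial (2 * (n - m) + 1) (2 * m) J (x, 0))"

definition Ez_odd_term :: "(real \<times> real \<Rightarrow> real) \<Rightarrow> real \<Rightarrow> real \<Rightarrow> nat \<Rightarrow> real" where
  "Ez_odd_term J x \<theta> n =
     \<theta> ^ (2 * n + 1) / fact (2 * n + 1) *
       (\<Sum>m=0..n. mixed_partial (2 * (n - m)) (2 * m) J (x, 0))"

definition Hy :: "(real \<times> real \<Rightarrow> real) \<Rightarrow> real \<times> real \<Rightarrow> real" where
  "Hy J = (\<lambda>(x, \<theta>). - (\<Sum>n. Hy_even_term J x \<theta> n) - (\<Sum>n. Hy_odd_term J x \<theta> n))"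

definition Ez :: "real \<Rightarrow> (real \<times> real \<Rightarrow> real) \<Rightarrow> real \<times> real \<Rightarrow> real" where
  "Ez \<eta> J = (\<lambda>(x, \<theta>). - \<eta> * (\<Sum>n. Ez_even_term J x \<theta> n) - \<eta> * (\<Sum>n. Ez_odd_term J x \<theta> n))"

text \<open>
  The pair \<open>(H, E)\<close> solves the one-dimensional Maxwell problem with source \<open>J\<close> and zero initial
  values on the rectangle \<open>\<bar>x\<bar> \<le> xmax\<close>, \<open>0 \<le> \<theta> \<le> \<theta>max\<close>. The four partial derivatives are required
  to exist; they are taken within the rectangle, hence two-sided at interior points and one-sided
  at boundary points. For \<open>xmax > 0\<close> and \<open>\<theta>max > 0\<close> their values are unique.
\<close>

definition solves_maxwell_1d ::
  "real \<Rightarrow> (real \<times> real \<Rightarrow> real) \<Rightarrow> real \<Rightarrow> real \<Rightarrow>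
   (real \<times> real \<Rightarrow> real) \<Rightarrow> (real \<times> real \<Rightarrow> real) \<Rightarrow> bool" where
  "solves_maxwell_1d \<eta> J xmax \<theta>max H E \<longleftrightarrow>
     (\<forall>x\<in>{-xmax..xmax}. \<forall>\<theta>\<in>{0..\<theta>max}. \<exists>H\<theta> Hx E\<theta> Ex.
        ((\<lambda>s. H (x, s)) has_real_derivative H\<theta>) (at \<theta> within {0..\<theta>max}) \<and>
        ((\<lambda>y. H (y, \<theta>)) has_real_derivative Hx) (at x within {-xmax..xmax}) \<and>
        ((\<lambda>s. E (x, s)) has_real_derivative E\<theta>) (at \<theta> within {0..\<theta>max}) \<and>
        ((\<lambda>y. E (y, \<theta>)) has_real_derivative Ex) (at x within {-xmax..xmax}) \<and>
        H\<theta> = (1 / \<eta>) * Ex \<and>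
        E\<theta> = \<eta> * Hx - \<eta> * J (x, \<theta>)) \<and>
     (\<forall>x\<in>{-xmax..xmax}. H (x, 0) = 0 \<and> E (x, 0) = 0)"

end

theory Submission
  imports Defs "HOL-Complex_Analysis.Cauchy_Integral_Formula"
begin

text \<open>
  Let \<open>W\<^sub>\<sigma> (x, \<theta>)\<close> be the integral of \<open>J (x + \<sigma> (\<theta> - s), s)\<close> over \<open>0 \<le> s \<le> \<theta>\<close>. Integrating along the
  characteristics shows that \<open>- (W\<^sub>1 - W\<^sub>-\<^sub>1) / 2\<close> and \<open>- \<eta> (W\<^sub>1 + W\<^sub>-\<^sub>1) / 2\<close> solve the Maxwell problem,
  and the given series are the Taylor series of these two functions in \<open>\<theta>\<close> at \<open>\<theta> = 0\<close>. For fixed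
  \<open>x\<close> both functions are analytic in \<open>\<theta>\<close>, because the Cauchy estimates of \<open>J\<close> on compact sets carry
  over to them. Hence they agree with their Taylor series on \<open>[0, \<theta>max)\<close>, and by Abel's limit
  theorem also at \<open>\<theta>max\<close>. The argument is pointwise in \<open>x\<close>, so no uniformity in \<open>x\<close> of the
  convergence is needed, and the series are never differentiated in \<open>x\<close> term by term.
\<close>

section \<open>Analytic functions of one variable\<close>

text \<open>The binomial coefficient \<open>(k + j) choose k\<close> is at most 2 to the power
  \<open>k + j\<close>. This splits a factorial bound of order \<open>k + j\<close> into one factor
  per index, at the price of doubling the radius constant.\<close>

lemma fact_add_le: "fact (k + j) \<le> (2 ^ (k + j) * fact k * fact j :: real)"
proof -
  have "real ((k + j) choose k) \<le> real (2 ^ (k + j))"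
    using binomial_le_pow2[of "k + j" k] by (simp only: of_nat_le_iff)
  moreover have "real ((k + j) choose k) = fact (k + j) / (fact k * fact j)"
    by (subst binomial_fact) auto
  ultimately show ?thesis by (simp add: divide_simps mult_ac)
qed

text \<open>Here \<open>d k\<close> is the \<open>k\<close>-th derivative of \<open>d 0\<close>, and
  the factorial bounds express real analyticity on the closed interval. This is the identity theorem
  for a zero of infinite order at 0, proved by Taylor's theorem in steps of fixed length.\<close>

lemma flat_function_zero:
  fixes d :: "nat \<Rightarrow> real \<Rightarrow> real"
  assumes der: "\<And>k t. t \<in> {0..T} \<Longrightarrow> (d k has_real_derivative d (Suc k) t) (at t within {0..T})"
    and bd: "\<And>k t. t \<in> {0..T} \<Longrightarrow> \<bar>d k t\<bar> \<le> C * R ^ k * fact k"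
    and z: "\<And>k. d k 0 = 0" and R: "R > 0" and t: "t \<in> {0..T}"
  shows "d 0 t = 0"
proof -
  \<comment> \<open>Up to a constant, the remainder of order \<open>n\<close> at distance
    \<open>\<delta>\<close> is \<open>(n + 1) * (2 * R * \<delta>) ^ (n + 1)\<close>, where the 2
    comes from \<open>fact_add_le\<close>; this choice gives the ratio 1/2.\<close>
  define \<delta> where "\<delta> = 1 / (4 * R)"
  have \<delta>: "\<delta> > 0" "R * \<delta> = 1/4" using R by (auto simp: \<delta>_def)
  have C: "C \<ge> 0" using bd[of 0 0] z[of 0] t by auto
  \<comment> \<open>Taylor's theorem carries vanishing at \<open>a\<close> over a distance \<open>\<delta>\<close> that does not depend on \<open>a\<close>.\<close>
  have step: "d k b = 0" if a: "a \<in> {0..T}" and b: "b \<in> {0..T}" and ab: "\<bar>b - a\<bar> \<le> \<delta>"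
    and da: "\<And>k. d k a = 0" for a b k
  proof -
    have "\<bar>d k b\<bar> \<le> (C * (2 * R) ^ k * fact k) * (real (Suc n) * (1/2) ^ Suc n)" for n
    proof -
      have "norm (d (k + 0) b - (\<Sum>i\<le>n. d (k + i) a * (b - a) ^ i / fact i))
        \<le> (C * R ^ (k + Suc n) * fact (k + Suc n)) * norm (b - a) ^ Suc n / fact n"
        by (rule field_Taylor[where S = "{0..T}" and f = "\<lambda>i. d (k + i)"])
          (use a b der bd in \<open>auto simp del: fact_Suc power_Suc\<close>)
      then have "\<bar>d k b\<bar> \<le> (C * R ^ (k + Suc n) * fact (k + Suc n)) * \<bar>b - a\<bar> ^ Suc n / fact n"
        by (simp add: da)
      also have "\<dots> \<le> (C * R ^ (k + Suc n) * (2 ^ (k + Suc n) * fact k * fact (Suc n))) * \<delta> ^ Suc n / fact n"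
      proof -
        have "fact (k + Suc n) \<le> (2 ^ (k + Suc n) * fact k * fact (Suc n) :: real)"
          by (rule fact_add_le)
        then show ?thesis
          using C R \<delta> ab by (intro divide_right_mono mult_mono power_mono mult_left_mono) auto
      qed
      also have "\<dots> = (C * (2 * R) ^ k * fact k) * (real (Suc n) * (2 * (R * \<delta>)) ^ Suc n)"
        by (simp add: power_add power_mult_distrib field_simps)
      also have "\<dots> = (C * (2 * R) ^ k * fact k) * (real (Suc n) * (1/2) ^ Suc n)"
        by (simp add: \<delta>)
      finally show ?thesis .
    qed
    moreover have "(\<lambda>n. (C * (2 * R) ^ k * fact k) * (real (Suc n) * (1/2) ^ Suc n)) \<longlonglongrightarrow> (C * (2 * R) ^ k * fact k) * 0"
      using powser_times_n_limit_0[of "1/2 :: real"] by (intro tendsto_mult_left LIMSEQ_Suc) simp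
    ultimately have "\<bar>d k b\<bar> \<le> (C * (2 * R) ^ k * fact k) * 0"
      by (meson LIMSEQ_le_const)
    then show ?thesis by simp
  qed
  have "\<forall>t \<in> {0..T}. t \<le> real n * \<delta> \<longrightarrow> (\<forall>k. d k t = 0)" for n
  proof (induction n)
    case 0
    then show ?case using z by auto
  next
    case (Suc n)
    show ?case
    proof (intro ballI impI allI)
      fix t k assume t: "t \<in> {0..T}" "t \<le> real (Suc n) * \<delta>"
      \<comment> \<open>A point covered by the induction hypothesis and at distance at most
        \<open>\<delta>\<close> from \<open>t\<close>, also when \<open>t\<close> is itself already
        covered.\<close>
      define a where "a = min t (real n * \<delta>)"
      have a: "a \<in> {0..T}" "a \<le> real n * \<delta>" using t \<delta> by (auto simp: a_def)
      have "\<bar>t - a\<bar> \<le> \<delta>" using t \<delta> by (auto simp: a_def min_def algebra_simps)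
      moreover have "d k a = 0" for k using Suc a by blast
      ultimately show "d k t = 0" by (rule step[OF a(1) t(1)])
    qed
  qed
  moreover obtain n where "t / \<delta> \<le> real n" using real_arch_simple by blast
  then have "t \<le> real n * \<delta>" using \<delta> by (simp add: pos_divide_le_eq)
  ultimately show ?thesis using t by blast
qed

text \<open>The error \<open>f x - S\<close> is an average of the errors \<open>s n\<close> of the
  partial sums with weights \<open>(1 - x) * x ^ n\<close>. These weights sum to 1 and each of them
  tends to 0 as \<open>x\<close> tends to 1, so only late and hence small errors count.\<close>

lemma Abel_limit:
  fixes c :: "nat \<Rightarrow> real"
  assumes c: "c sums S" and f: "\<And>x. 0 \<le> x \<Longrightarrow> x < 1 \<Longrightarrow> (\<lambda>n. c n * x ^ n) sums f x"
  shows "(f \<longlongrightarrow> S) (at_left 1)"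
proof -
  define s where "s n = (\<Sum>k\<le>n. c k) - S" for n
  have s0: "s \<longlonglongrightarrow> 0"
    using c unfolding s_def sums_def_le by (simp add: LIM_zero)
  \<comment> \<open>Summation by parts.\<close>
  have key: "(\<lambda>n. (1 - x) * (s n * x ^ n)) sums (f x - S)" if x: "0 \<le> x" "x < 1" for x
  proof -
    have "Bseq s" using s0 by (auto intro: convergent_imp_Bseq convergentI)
    then obtain B where B: "\<And>n. norm (s n) \<le> B" by (auto simp: Bseq_def)
    have "summable (\<lambda>n. s n * x ^ n)"
    proof (rule summable_comparison_test)
      show "\<exists>N. \<forall>n\<ge>N. norm (s n * x ^ n) \<le> B * x ^ n"
        using B x by (auto simp: abs_mult power_abs intro!: mult_right_mono exI[of _ 0])
      show "summable (\<lambda>n. B * x ^ n)" using x by (intro summable_mult summable_geometric) auto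
    qed
    then obtain L where L: "(\<lambda>n. s n * x ^ n) sums L" by (auto simp: summable_def)
    have L1: "(\<lambda>n. s (Suc n) * x ^ Suc n) sums (L - s 0)"
      using L sums_Suc_iff[of "\<lambda>n. s n * x ^ n" "L - s 0"] by simp
    have "(\<lambda>n. s (Suc n) * x ^ Suc n - x * (s n * x ^ n)) sums ((L - s 0) - x * L)"
      by (intro sums_diff L1 sums_mult L)
    moreover have "s (Suc n) * x ^ Suc n - x * (s n * x ^ n) = c (Suc n) * x ^ Suc n" for n
      by (simp add: s_def algebra_simps)
    ultimately have "(\<lambda>n. c (Suc n) * x ^ Suc n) sums ((L - s 0) - x * L)" by simp
    moreover have "(\<lambda>n. c (Suc n) * x ^ Suc n) sums (f x - c 0)"
      using f[OF x] sums_Suc_iff[of "\<lambda>n. c n * x ^ n" "f x - c 0"] by simp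
    ultimately have "(L - s 0) - x * L = f x - c 0" by (rule sums_unique2)
    then have "f x - S = (1 - x) * L" by (simp add: s_def algebra_simps)
    then show ?thesis using sums_mult[OF L, of "1 - x"] by simp
  qed
  show ?thesis
  proof (rule tendstoI)
    fix e :: real assume e: "e > 0"
    obtain N where N: "\<And>n. n \<ge> N \<Longrightarrow> \<bar>s n\<bar> \<le> e / 2"
      using LIMSEQ_D[OF s0, of "e/2"] e by (metis diff_zero half_gt_zero less_imp_le real_norm_def)
    define P where "P = (\<Sum>n<N. \<bar>s n\<bar>)"
    have P: "P \<ge> 0" by (simp add: P_def sum_nonneg)
    \<comment> \<open>The indices from \<open>N\<close> on contribute at most \<open>e / 2\<close>;
      this threshold makes \<open>(1 - x) * P\<close> smaller than \<open>e / 2\<close> as well.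
      Adding 1 to \<open>P\<close> keeps the denominator positive when \<open>P = 0\<close>.\<close>
    have "dist (f x) S < e" if x: "max 0 (1 - e / (2 * (P + 1))) < x" "x < 1" for x
    proof -
      have x0: "0 \<le> x" using x by auto
      have a: "(\<lambda>n. if n < N then (1 - x) * \<bar>s n\<bar> else 0) sums ((1 - x) * P)"
        using sums_If_finite[of "\<lambda>n. n < N" "\<lambda>n. (1 - x) * \<bar>s n\<bar>"]
        by (simp add: P_def sum_distrib_left lessThan_def)
      have b: "(\<lambda>n. (1 - x) * (e / 2) * x ^ n) sums ((1 - x) * (e / 2) * (1 / (1 - x)))"
        using x x0 by (intro sums_mult geometric_sums) auto
      have le: "\<bar>(1 - x) * (s n * x ^ n)\<bar> \<le> (if n < N then (1 - x) * \<bar>s n\<bar> else 0) + (1 - x) * (e / 2) * x ^ n" for n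
      proof (cases "n < N")
        case True
        have "\<bar>s n\<bar> * x ^ n \<le> \<bar>s n\<bar> * 1" using x x0 by (intro mult_left_mono power_le_one) auto
        then have "(1 - x) * (\<bar>s n\<bar> * x ^ n) \<le> (1 - x) * \<bar>s n\<bar>"
          using x by (intro mult_left_mono) auto
        moreover have "0 \<le> (1 - x) * (e / 2) * x ^ n" using x x0 e by auto
        moreover have "\<bar>(1 - x) * (s n * x ^ n)\<bar> = (1 - x) * (\<bar>s n\<bar> * x ^ n)"
          using x x0 by (simp add: abs_mult power_abs)
        ultimately show ?thesis unfolding if_P[OF True] by linarith
      next
        case False
        have "\<bar>s n\<bar> * x ^ n \<le> e / 2 * x ^ n" using N[of n] False x0 by (intro mult_right_mono) auto
        then have "(1 - x) * (\<bar>s n\<bar> * x ^ n) \<le> (1 - x) * (e / 2 * x ^ n)"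
          using x by (intro mult_left_mono) auto
        then show ?thesis using False x x0 by (simp add: abs_mult power_abs mult_ac)
      qed
      have "\<bar>f x - S\<bar> \<le> (1 - x) * P + (1 - x) * (e / 2) * (1 / (1 - x))"
      proof (rule abs_leI)
        show "f x - S \<le> (1 - x) * P + (1 - x) * (e / 2) * (1 / (1 - x))"
          by (rule sums_le[OF _ key[OF x0 x(2)] sums_add[OF a b]]) (use le in \<open>simp add: abs_le_iff\<close>)
        show "- (f x - S) \<le> (1 - x) * P + (1 - x) * (e / 2) * (1 / (1 - x))"
          by (rule sums_le[OF _ sums_minus[OF key[OF x0 x(2)]] sums_add[OF a b]]) (use le in \<open>simp add: abs_le_iff\<close>)
      qed
      also have "(1 - x) * (e / 2) * (1 / (1 - x)) = e / 2"
      proof -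
        have "y * (e / 2) * (1 / y) = e / 2" if "y \<noteq> 0" for y using that by simp
        then show ?thesis using x by (metis less_irrefl right_minus_eq)
      qed
      also have "(1 - x) * P \<le> (1 - x) * (P + 1)" using x by (intro mult_left_mono) auto
      also have "(1 - x) * (P + 1) < e / (2 * (P + 1)) * (P + 1)"
        using x P by (intro mult_strict_right_mono) auto
      also have "\<dots> = e / 2"
      proof -
        have "e / (2 * y) * y = e / 2" if "y > 0" for y using that by simp
        then show ?thesis using P by (meson add_nonneg_pos zero_less_one)
      qed
      finally show ?thesis by (simp add: dist_real_def)
    qed
    moreover have "max 0 (1 - e / (2 * (P + 1))) < 1" using e P by auto
    ultimately show "\<forall>\<^sub>F x in at_left 1. dist (f x) S < e"
      unfolding eventually_at_left_field by (intro exI[of _ "max 0 (1 - e / (2 * (P + 1)))"]) auto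
  qed
qed

section \<open>Convergence of a Taylor series to its function\<close>

text \<open>The difference of the two series sums to zero on the whole ball, whereas a nonzero
  coefficient would make the zero at \<open>\<xi>\<close> isolated.\<close>

lemma powser_coeffs_unique:
  fixes a b :: "nat \<Rightarrow> 'a::{real_normed_field, banach}"
  assumes r: "0 < r" and a: "\<And>x. x \<in> ball \<xi> r \<Longrightarrow> (\<lambda>n. a n * (x - \<xi>) ^ n) sums f x"
    and b: "\<And>x. x \<in> ball \<xi> r \<Longrightarrow> (\<lambda>n. b n * (x - \<xi>) ^ n) sums f x"
  shows "a m = b m"
proof (rule ccontr)
  assume m: "a m \<noteq> b m"
  have *: "(\<lambda>n. (a n - b n) * (x - \<xi>) ^ n) sums 0" if "norm (x - \<xi>) < r" for x
    using sums_diff[OF a b, of x x] that by (simp add: algebra_simps dist_norm norm_minus_commute)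
  \<comment> \<open>The isolation result applies to a nonzero coefficient of positive index, so the
    constant terms are compared first, at the centre.\<close>
  have "a 0 - b 0 = 0"
    using *[of \<xi>] r by (simp del: powser_sums_zero_iff add: powser_sums_zero_iff[of "\<lambda>n. a n - b n"])
  then have "m > 0" using m by (cases m) auto
  obtain s where "0 < s" "\<And>z. z \<in> cball \<xi> s - {\<xi>} \<Longrightarrow> (0::'a) \<noteq> 0"
    using powser_0_nonzero[OF r *, of m] m \<open>m > 0\<close> by auto
  moreover have "\<xi> + of_real s \<in> cball \<xi> s - {\<xi>}" using \<open>0 < s\<close> by (auto simp: dist_norm)
  ultimately show False by blast
qed

text \<open>For \<open>t < T\<close> the Taylor series is a holomorphic function with the same
  derivatives at 0 as \<open>f 0\<close>. The difference is flat at 0 and obeys factorial bounds on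
  \<open>[0, t]\<close>, so it vanishes. At \<open>T\<close> itself Abel's limit theorem and
  continuity conclude.\<close>

lemma taylor_sums_of_factorial_bound:
  fixes f :: "nat \<Rightarrow> real \<Rightarrow> real"
  assumes T: "T > 0"
    and der: "\<And>k t. t \<in> {0..T} \<Longrightarrow> (f k has_real_derivative f (Suc k) t) (at t within {0..T})"
    and bd: "\<And>k t. t \<in> {0..T} \<Longrightarrow> \<bar>f k t\<bar> \<le> C * R ^ k * fact k" and R: "R > 0"
    and sm: "summable (\<lambda>k. f k 0 / fact k * T ^ k)"
    and t: "t \<in> {0..T}"
  shows "(\<lambda>k. f k 0 / fact k * t ^ k) sums f 0 t"
proof -
  define c where "c k = f k 0 / fact k" for k
  have inner: "(\<lambda>k. c k * t ^ k) sums f 0 t" if t: "0 \<le> t" "t < T" for t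
  proof -
    \<comment> \<open>Summability at \<open>T\<close> makes the series converge on the open complex
      disc of radius \<open>T\<close>, where Cauchy's inequality supplies factorial bounds for all
      derivatives of its sum.\<close>
    define G where "G = (\<lambda>z::complex. \<Sum>k. of_real (c k) * z ^ k)"
    have Gs: "(\<lambda>k. of_real (c k) * (w - 0) ^ k) sums G w" if "w \<in> ball 0 T" for w
    proof -
      have "summable (\<lambda>k. complex_of_real (c k) * of_real T ^ k)"
        using sm summable_of_real[of "\<lambda>k. c k * T ^ k", where 'a = complex] by (simp add: c_def)
      then show ?thesis
        unfolding G_def using that T powser_inside[of "\<lambda>k. complex_of_real (c k)" "of_real T" w]
        by (simp add: summable_sums)
    qed
    have hG: "G holomorphic_on ball 0 T"
      by (rule power_series_holomorphic[OF Gs])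
    have der0: "(deriv ^^ k) G 0 = of_real (f k 0)" for k
    proof -
      have "(deriv ^^ k) G 0 / fact k = of_real (c k)"
        by (rule powser_coeffs_unique[OF T _ Gs, of "\<lambda>k. (deriv ^^ k) G 0 / fact k"])
          (use holomorphic_power_series[OF hG] in auto)
      then show ?thesis by (simp add: c_def field_simps)
    qed
    \<comment> \<open>Half of the gap between \<open>t\<close> and \<open>T\<close>: the discs of
      radius \<open>\<rho>\<close> about points of \<open>[0, t]\<close> then lie in a compact disc
      of radius \<open>M < T\<close>, on which \<open>G\<close> is bounded.\<close>
    define \<rho> where "\<rho> = (T - t) / 2"
    have \<rho>: "\<rho> > 0" using t by (simp add: \<rho>_def)
    define M where "M = t + \<rho>"
    have M: "0 < M" "M < T" using t by (auto simp: M_def \<rho>_def field_simps)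
    have "compact (G ` cball 0 M)"
      using M by (intro compact_continuous_image holomorphic_on_imp_continuous_on[OF holomorphic_on_subset[OF hG]]) auto
    then obtain B where B: "\<And>z. z \<in> cball 0 M \<Longrightarrow> norm (G z) \<le> B"
      using compact_imp_bounded bounded_iff by (metis imageI)
    then have "B \<ge> 0" using M by (metis centre_in_cball less_imp_le norm_ge_zero order_trans)
    have Gb: "norm ((deriv ^^ k) G (of_real s)) \<le> fact k * B / \<rho> ^ k" if s: "s \<in> {0..t}" for s k
    proof (rule Cauchy_inequality[OF _ _ \<rho>])
      have sub: "cball (of_real s) \<rho> \<subseteq> cball (0::complex) M"
        using s by (auto simp: M_def cball_subset_cball_iff dist_norm)
      then have sub2: "cball (of_real s) \<rho> \<subseteq> ball (0::complex) T" using M by force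
      show "G holomorphic_on ball (of_real s) \<rho>"
        using sub2 ball_subset_cball by (blast intro: holomorphic_on_subset[OF hG])
      show "continuous_on (cball (of_real s) \<rho>) G"
        using sub2 by (blast intro: holomorphic_on_imp_continuous_on holomorphic_on_subset[OF hG])
      show "norm (G z) \<le> B" if "norm (of_real s - z) = \<rho>" for z
        using that sub by (intro B) (auto simp: dist_norm)
    qed
    \<comment> \<open>By \<open>der0\<close> every \<open>d k\<close> vanishes at 0. Taking real
      parts turns the complex derivatives of \<open>G\<close> into real derivatives along the real
      axis.\<close>
    define d where "d k s = f k s - Re ((deriv ^^ k) G (of_real s))" for k s
    have "d 0 t = 0"
    proof (rule flat_function_zero[of t d "C + B" "max R (1 / \<rho>)"])
      fix k s assume s: "s \<in> {0..t}"
      have "(f k has_real_derivative f (Suc k) s) (at s within {0..t})"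
        by (rule DERIV_subset[OF der]) (use s t in auto)
      moreover have "((\<lambda>s. Re ((deriv ^^ k) G (of_real s))) has_real_derivative Re ((deriv ^^ Suc k) G (of_real s))) (at s within {0..t})"
      proof -
        have "((deriv ^^ k) G has_field_derivative (deriv ^^ Suc k) G (of_real s)) (at (of_real s))"
          by (rule has_field_derivative_higher_deriv[OF hG]) (use s t in auto)
        from bounded_linear.has_vector_derivative[OF bounded_linear_Re has_vector_derivative_real_field[OF this]]
        show ?thesis by (simp add: has_real_derivative_iff_has_vector_derivative)
      qed
      ultimately show "(d k has_real_derivative d (Suc k) s) (at s within {0..t})"
        unfolding d_def[abs_def] by (rule DERIV_diff)
      have "\<bar>d k s\<bar> \<le> \<bar>f k s\<bar> + \<bar>Re ((deriv ^^ k) G (of_real s))\<bar>"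
        unfolding d_def by linarith
      also have "\<dots> \<le> C * R ^ k * fact k + fact k * B / \<rho> ^ k"
        using bd[of s k] Gb[OF s, of k] abs_Re_le_cmod[of "(deriv ^^ k) G (of_real s)"] s t by auto
      also have "\<dots> = (C * R ^ k + B * (1 / \<rho>) ^ k) * fact k"
        by (simp add: field_simps)
      also have "\<dots> \<le> (C * max R (1 / \<rho>) ^ k + B * max R (1 / \<rho>) ^ k) * fact k"
      proof -
        have "C \<ge> 0" using bd[of 0 0] T by auto
        then show ?thesis using \<open>B \<ge> 0\<close> R \<rho>
          by (intro mult_right_mono add_mono mult_left_mono power_mono) auto
      qed
      finally show "\<bar>d k s\<bar> \<le> (C + B) * max R (1 / \<rho>) ^ k * fact k"
        by (simp add: algebra_simps)
    qed (use t R der0 in \<open>auto simp: d_def\<close>)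
    then have "f 0 t = Re (G (of_real t))" by (simp add: d_def)
    moreover have "(\<lambda>k. Re (of_real (c k) * (of_real t - 0) ^ k)) sums Re (G (of_real t))"
      by (rule sums_Re[OF Gs]) (use t in auto)
    ultimately show ?thesis by (simp flip: of_real_power)
  qed
  show ?thesis
  proof (cases "t = T")
    case False
    then show ?thesis using inner[of t] t by (simp add: c_def)
  next
    case True
    have S: "(\<lambda>k. c k * T ^ k) sums (\<Sum>k. c k * T ^ k)"
      using sm by (simp add: c_def summable_sums)
    \<comment> \<open>Rescaling by \<open>T\<close> moves the end point to 1. The same left limit is
      computed twice, by Abel's theorem as the sum of the series and by continuity as
      \<open>f 0 T\<close>.\<close>
    have "((\<lambda>x. f 0 (T * x)) \<longlongrightarrow> (\<Sum>k. c k * T ^ k)) (at_left 1)"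
    proof (rule Abel_limit[OF S])
      fix x :: real assume "0 \<le> x" "x < 1"
      then show "(\<lambda>k. c k * T ^ k * x ^ k) sums f 0 (T * x)"
        using inner[of "T * x"] T by (simp add: power_mult_distrib mult_ac)
    qed
    moreover have "((\<lambda>x. f 0 (T * x)) \<longlongrightarrow> f 0 T) (at_left 1)"
    proof -
      have "continuous_on {0..T} (f 0)"
        using der by (meson DERIV_continuous continuous_on_eq_continuous_within)
      then have "continuous_on {0..1} (\<lambda>x. f 0 (T * x))"
        by (rule continuous_on_compose2) (use T in \<open>auto intro!: continuous_intros mult_left_le\<close>)
      then show ?thesis
        using continuous_on_Icc_at_leftD[of 0 1 "\<lambda>x. f 0 (T * x)"] by simp
    qed
    ultimately have "(\<Sum>k. c k * T ^ k) = f 0 T"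
      using tendsto_unique[OF trivial_limit_at_left_real] by blast
    then show ?thesis using S True by (simp add: c_def)
  qed
qed

section \<open>Double power series\<close>

text \<open>Names the coefficients and the radius that \<open>real_analytic2_at\<close> only asserts
  to exist, so that differentiation becomes an explicit operation on coefficients with the radius
  unchanged.\<close>

definition double_powser :: "(nat \<Rightarrow> nat \<Rightarrow> real) \<Rightarrow> real \<Rightarrow> (real \<times> real \<Rightarrow> real) \<Rightarrow> real \<times> real \<Rightarrow> bool" where
  "double_powser a r f p \<longleftrightarrow> r > 0 \<and>
     (\<forall>u v. \<bar>u\<bar> < r \<longrightarrow> \<bar>v\<bar> < r \<longrightarrow>
        ((\<lambda>(i, j). a i j * u ^ i * v ^ j) has_sum f (fst p + u, snd p + v)) UNIV)"

lemma has_sum_prod: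
  fixes g h :: "nat \<Rightarrow> real"
  assumes "\<And>i. g i \<ge> 0" "\<And>i. h i \<ge> 0" "(g has_sum G) UNIV" "(h has_sum H) UNIV"
  shows "((\<lambda>(i, j). g i * h j) has_sum G * H) UNIV"
proof -
  have 1: "((\<lambda>j. (\<lambda>(i, j). g i * h j) (i, j)) has_sum g i * H) UNIV" for i
    using has_sum_cmult_right[OF assms(4), of "g i"] by simp
  have 2: "((\<lambda>i. g i * H) has_sum G * H) UNIV"
    using has_sum_cmult_left[OF assms(3), of H] by simp
  have "(\<lambda>(i, j). g i * h j) summable_on (Sigma UNIV (\<lambda>_. UNIV))"
    by (rule summable_on_SigmaI[OF 1]) (use 2 assms in \<open>auto simp: summable_on_def\<close>)
  then have "((\<lambda>(i, j). g i * h j) has_sum G * H) (Sigma UNIV (\<lambda>_. UNIV))"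
    by (intro has_sum_SigmaI[OF 1 2])
  then show ?thesis by simp
qed

lemma abs_has_sum_le:
  fixes f g :: "'a \<Rightarrow> real"
  assumes "(f has_sum s) A" and "\<And>x. \<bar>f x\<bar> \<le> g x" and "(g has_sum t) A"
  shows "\<bar>s\<bar> \<le> t"
proof -
  have "s \<le> t"
    using assms(2) by (intro has_sum_mono[OF assms(1,3)]) (auto simp: abs_le_iff)
  moreover have "- s \<le> t"
    using assms(2) by (intro has_sum_mono[OF has_sum_uminusI[OF assms(1)] assms(3)]) (auto simp: abs_le_iff)
  ultimately show ?thesis by simp
qed

lemma has_sum_geometric:
  fixes q :: real
  assumes "0 \<le> q" "q < 1"
  shows "((\<lambda>i. q ^ i) has_sum 1 / (1 - q)) UNIV"
  using geometric_sums[of q] assms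
  by (intro sums_nonneg_imp_has_sum) auto

lemma summable_on_linear_geometric:
  fixes q :: real
  assumes "0 \<le> q" "q < 1"
  shows "(\<lambda>i. real (Suc i) * q ^ i) summable_on UNIV"
proof -
  have "(\<lambda>i. real (Suc i) * q ^ i) sums (1 / (1 - q)\<^sup>2)"
    using geometric_deriv_sums[of q] assms by simp
  then show ?thesis
    using sums_nonneg_imp_has_sum[of "\<lambda>i. real (Suc i) * q ^ i"] assms unfolding summable_on_def by auto
qed

lemma double_powser_has_sum:
  assumes "double_powser a r f p" "\<bar>fst q - fst p\<bar> < r" "\<bar>snd q - snd p\<bar> < r"
  shows "((\<lambda>(i, j). a i j * (fst q - fst p) ^ i * (snd q - snd p) ^ j) has_sum f q) UNIV"
proof -
  have "((\<lambda>(i, j). a i j * (fst q - fst p) ^ i * (snd q - snd p) ^ j) has_sum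
    f (fst p + (fst q - fst p), snd p + (snd q - snd p))) UNIV"
    using assms unfolding double_powser_def by blast
  then show ?thesis by simp
qed

lemma double_powser_summable:
  assumes "double_powser a r f p" "\<bar>u\<bar> < r" "\<bar>v\<bar> < r"
  shows "(\<lambda>(i, j). a i j * u ^ i * v ^ j) summable_on UNIV"
  using assms unfolding double_powser_def by (blast intro: has_sum_imp_summable)

text \<open>Convergence at the corner \<open>(\<rho>, \<rho>)\<close> is absolute, and a single term
  there is at most the sum of all absolute values.\<close>

lemma double_powser_coeff_bound:
  assumes "double_powser a r f p" "0 < \<rho>" "\<rho> < r"
  obtains A where "A \<ge> 0" "\<And>i j. \<bar>a i j\<bar> \<le> A / \<rho> ^ (i + j)"
proof -
  have "(\<lambda>(i, j). a i j * \<rho> ^ i * \<rho> ^ j) summable_on UNIV"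
    using double_powser_summable[OF assms(1), of \<rho> \<rho>] assms(2,3) by simp
  then have s: "(\<lambda>x. \<bar>case x of (i, j) \<Rightarrow> a i j * \<rho> ^ i * \<rho> ^ j\<bar>) summable_on UNIV"
    by (rule iffD1[OF summable_on_iff_abs_summable_on_real, unfolded real_norm_def])
  define A where "A = infsum (\<lambda>x. \<bar>case x of (i, j) \<Rightarrow> a i j * \<rho> ^ i * \<rho> ^ j\<bar>) UNIV"
  have "\<bar>a i j * \<rho> ^ i * \<rho> ^ j\<bar> \<le> A" for i j
    using finite_sum_le_infsum[OF s, of "{(i, j)}"] unfolding A_def by simp
  then have "\<bar>a i j\<bar> \<le> A / \<rho> ^ (i + j)" for i j
    using assms(2) by (simp add: field_simps power_add abs_mult)
  moreover have "A \<ge> 0" unfolding A_def by (rule infsum_nonneg) auto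
  ultimately show ?thesis using that by blast
qed

text \<open>By this symmetry the facts about the second variable follow from those about the
  first.\<close>

lemma double_powser_swap:
  assumes "double_powser a r f p"
  shows "double_powser (\<lambda>i j. a j i) r (\<lambda>q. f (snd q, fst q)) (snd p, fst p)"
  unfolding double_powser_def
proof (intro conjI allI impI)
  show "r > 0" using assms by (simp add: double_powser_def)
  fix u v :: real assume "\<bar>u\<bar> < r" "\<bar>v\<bar> < r"
  then have "((\<lambda>(i, j). a i j * v ^ i * u ^ j) has_sum f (fst p + v, snd p + u)) UNIV"
    using assms by (simp add: double_powser_def)
  then have "((\<lambda>(x, y). (\<lambda>(i, j). a i j * v ^ i * u ^ j) (y, x)) has_sum f (fst p + v, snd p + u)) (UNIV \<times> UNIV)"
    by (subst has_sum_swap[symmetric]) simp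
  then show "((\<lambda>(i, j). a j i * u ^ i * v ^ j) has_sum
           f (snd (fst (snd p, fst p) + u, snd (snd p, fst p) + v),
             fst (fst (snd p, fst p) + u, snd (snd p, fst p) + v))) UNIV"
    by (simp add: mult_ac)
qed

text \<open>For fixed \<open>v\<close>, summing over \<open>j\<close> first leaves a power series in
  one variable, which may be differentiated term by term. A geometric majorant makes the
  differentiated double series absolutely summable, so its unordered sum equals this iterated
  sum.\<close>

lemma double_powser_deriv_fst:
  assumes "double_powser a r f p"
  shows "double_powser (\<lambda>i j. real (Suc i) * a (Suc i) j) r (\<lambda>q. deriv (\<lambda>x. f (x, snd q)) (fst q)) p"
    and "\<bar>u\<bar> < r \<Longrightarrow> \<bar>v\<bar> < r \<Longrightarrow>
      ((\<lambda>x. f (x, snd p + v)) has_real_derivative deriv (\<lambda>x. f (x, snd p + v)) (fst p + u)) (at (fst p + u))"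
proof -
  have "((\<lambda>x. f (x, snd p + v)) has_real_derivative deriv (\<lambda>x. f (x, snd p + v)) (fst p + u)) (at (fst p + u))
    \<and> ((\<lambda>(i, j). real (Suc i) * a (Suc i) j * u ^ i * v ^ j) has_sum deriv (\<lambda>x. f (x, snd p + v)) (fst p + u)) UNIV"
    if u: "\<bar>u\<bar> < r" and v: "\<bar>v\<bar> < r" for u v
  proof -
    have hs: "((\<lambda>(i, j). a i j * w ^ i * v ^ j) has_sum f (fst p + w, snd p + v)) UNIV" if "\<bar>w\<bar> < r" for w
      using assms that v by (simp add: double_powser_def)
    \<comment> \<open>A radius strictly between the point and \<open>r\<close>, so that the ratios
      \<open>q\<close> and \<open>q'\<close> below are smaller than 1.\<close>
    obtain \<rho> where \<rho>: "max \<bar>u\<bar> \<bar>v\<bar> < \<rho>" "\<rho> < r"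
      using dense[of "max \<bar>u\<bar> \<bar>v\<bar>" r] u v by auto
    then have "\<rho> > 0" by auto
    obtain A where A: "A \<ge> 0" "\<And>i j. \<bar>a i j\<bar> \<le> A / \<rho> ^ (i + j)"
      using double_powser_coeff_bound[OF assms \<open>\<rho> > 0\<close> \<rho>(2)] by blast
    define q where "q = \<bar>u\<bar> / \<rho>"
    define q' where "q' = \<bar>v\<bar> / \<rho>"
    have q: "0 \<le> q" "q < 1" "0 \<le> q'" "q' < 1"
      using \<rho> \<open>\<rho> > 0\<close> by (auto simp: q_def q'_def)
    define b where "b i = (\<Sum>\<^sub>\<infinity>j. a i j * v ^ j)" for i
    have ab: "\<bar>a i j * v ^ j\<bar> \<le> A / \<rho> ^ i * q' ^ j" for i j
    proof -
      have "\<bar>a i j * v ^ j\<bar> \<le> A / \<rho> ^ (i + j) * \<bar>v\<bar> ^ j"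
        unfolding abs_mult power_abs by (intro mult_right_mono A) auto
      also have "\<dots> = A / \<rho> ^ i * q' ^ j"
        by (simp add: q'_def power_add power_divide)
      finally show ?thesis .
    qed
    have hb: "((\<lambda>j. a i j * v ^ j) has_sum b i) UNIV" for i
    proof -
      have "(\<lambda>j. A / \<rho> ^ i * q' ^ j) summable_on UNIV"
        using has_sum_cmult_right[OF has_sum_geometric[OF q(3,4)], of "A / \<rho> ^ i"]
        unfolding summable_on_def by blast
      then have "(\<lambda>j. norm (a i j * v ^ j)) summable_on UNIV"
        by (rule Infinite_Sum.abs_summable_on_comparison_test') (use ab in auto)
      then show ?thesis
        unfolding b_def by (rule has_sum_infsum[OF abs_summable_summable])
    qed
    have fb: "(\<lambda>i. b i * w ^ i) sums f (fst p + w, snd p + v)" if "\<bar>w\<bar> < r" for w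
    proof -
      have "((\<lambda>i. b i * w ^ i) has_sum f (fst p + w, snd p + v)) UNIV"
      proof (rule has_sum_SigmaD)
        show "((\<lambda>(i, j). a i j * w ^ i * v ^ j) has_sum f (fst p + w, snd p + v)) (Sigma UNIV (\<lambda>_. UNIV))"
          using hs[OF that] by simp
        show "((\<lambda>j. case (i, j) of (i, j) \<Rightarrow> a i j * w ^ i * v ^ j) has_sum b i * w ^ i) UNIV" for i
          using has_sum_cmult_left[OF hb[of i], of "w ^ i"] by (simp add: mult_ac)
      qed
      then show ?thesis by (rule has_sum_imp_sums)
    qed
    define D where "D = (\<Sum>i. diffs b i * u ^ i)"
    have sb: "summable (\<lambda>i. b i * z ^ i)" if "norm z < r" for z
      using fb[of z] that by (auto simp: sums_iff)
    have d1: "((\<lambda>w. \<Sum>i. b i * w ^ i) has_real_derivative D) (at u)"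
      unfolding D_def by (rule termdiffs_strong'[OF sb]) (use u in auto)
    have d2: "((\<lambda>w. f (fst p + w, snd p + v)) has_real_derivative D) (at u)"
    proof (rule has_field_derivative_transform_within_open[OF d1, of "{-r<..<r}"])
      show "(\<Sum>i. b i * w ^ i) = f (fst p + w, snd p + v)" if "w \<in> {-r<..<r}" for w
        using fb[of w] that by (auto simp: sums_iff abs_less_iff)
    qed (use u in auto)
    have d3: "((\<lambda>x. f (x, snd p + v)) has_real_derivative D) (at (fst p + u))"
      using d2 DERIV_shift[of "\<lambda>x. f (x, snd p + v)" D u "fst p"] by (simp add: add.commute)
    have S: "(\<lambda>(i, j). real (Suc i) * a (Suc i) j * u ^ i * v ^ j) summable_on UNIV"
    proof -
      have "(\<lambda>(i, j). (real (Suc i) * q ^ i) * q' ^ j) summable_on UNIV"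
        using has_sum_prod[of "\<lambda>i. real (Suc i) * q ^ i" "\<lambda>j. q' ^ j"]
          summable_on_linear_geometric[OF q(1,2)] has_sum_geometric[OF q(3,4)] q
        unfolding summable_on_def by auto
      then have "(\<lambda>z. A / \<rho> * (case z of (i, j) \<Rightarrow> (real (Suc i) * q ^ i) * q' ^ j)) summable_on UNIV"
        by (rule summable_on_cmult_right)
      then have "(\<lambda>z. norm (case z of (i, j) \<Rightarrow> real (Suc i) * a (Suc i) j * u ^ i * v ^ j)) summable_on UNIV"
      proof (rule Infinite_Sum.abs_summable_on_comparison_test', clarify)
        fix i j :: nat
        have "norm (real (Suc i) * a (Suc i) j * u ^ i * v ^ j) = real (Suc i) * \<bar>u\<bar> ^ i * \<bar>a (Suc i) j * v ^ j\<bar>"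
          by (simp add: abs_mult power_abs)
        also have "\<dots> \<le> real (Suc i) * \<bar>u\<bar> ^ i * (A / \<rho> ^ Suc i * q' ^ j)"
          by (intro mult_left_mono ab) auto
        also have "\<dots> = A / \<rho> * (real (Suc i) * q ^ i * q' ^ j)"
          by (simp add: q_def power_divide)
        finally show "norm (real (Suc i) * a (Suc i) j * u ^ i * v ^ j) \<le> A / \<rho> * (real (Suc i) * q ^ i * q' ^ j)" .
      qed
      then show ?thesis by (rule abs_summable_summable)
    qed
    \<comment> \<open>Summing the double series row by row gives the differentiated series in
      \<open>u\<close>, which identifies its total with \<open>D\<close>.\<close>
    have "((\<lambda>i. diffs b i * u ^ i) has_sum infsum (\<lambda>(i, j). real (Suc i) * a (Suc i) j * u ^ i * v ^ j) UNIV) UNIV"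
    proof (rule has_sum_SigmaD)
      show "((\<lambda>(i, j). real (Suc i) * a (Suc i) j * u ^ i * v ^ j) has_sum
           infsum (\<lambda>(i, j). real (Suc i) * a (Suc i) j * u ^ i * v ^ j) UNIV) (Sigma UNIV (\<lambda>_. UNIV))"
        using S by simp
      show "((\<lambda>j. case (i, j) of (i, j) \<Rightarrow> real (Suc i) * a (Suc i) j * u ^ i * v ^ j) has_sum diffs b i * u ^ i) UNIV" for i
        using has_sum_cmult_left[OF hb[of "Suc i"], of "real (Suc i) * u ^ i"] by (simp add: mult_ac diffs_def)
    qed
    then have "infsum (\<lambda>(i, j). real (Suc i) * a (Suc i) j * u ^ i * v ^ j) UNIV = D"
      unfolding D_def by (rule sums_unique[OF has_sum_imp_sums])
    then have hD: "((\<lambda>(i, j). real (Suc i) * a (Suc i) j * u ^ i * v ^ j) has_sum D) UNIV"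
      using has_sum_infsum[OF S] by simp
    show ?thesis
      using d3 hD DERIV_imp_deriv[OF d3] by simp
  qed
  then show "double_powser (\<lambda>i j. real (Suc i) * a (Suc i) j) r (\<lambda>q. deriv (\<lambda>x. f (x, snd q)) (fst q)) p"
    and "\<bar>u\<bar> < r \<Longrightarrow> \<bar>v\<bar> < r \<Longrightarrow>
      ((\<lambda>x. f (x, snd p + v)) has_real_derivative deriv (\<lambda>x. f (x, snd p + v)) (fst p + u)) (at (fst p + u))"
    using assms by (auto simp: double_powser_def)
qed

lemma double_powser_deriv_snd:
  assumes "double_powser a r f p"
  shows "double_powser (\<lambda>i j. real (Suc j) * a i (Suc j)) r (\<lambda>q. deriv (\<lambda>t. f (fst q, t)) (snd q)) p"
    and "\<bar>u\<bar> < r \<Longrightarrow> \<bar>v\<bar> < r \<Longrightarrow>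
      ((\<lambda>t. f (fst p + u, t)) has_real_derivative deriv (\<lambda>t. f (fst p + u, t)) (snd p + v)) (at (snd p + v))"
  using double_powser_swap[OF double_powser_deriv_fst(1)[OF double_powser_swap[OF assms]]] double_powser_deriv_fst(2)[OF double_powser_swap[OF assms], of v u]
  by simp_all

text \<open>Weierstrass M-test on a closed square, with the terms at its corner as majorants. The
  integrals along characteristics need this joint continuity, which the mere existence of partial
  derivatives would not give.\<close>

lemma isCont_double_powser:
  assumes "double_powser a r f p"
  shows "isCont f p"
proof -
  define \<rho> where "\<rho> = r / 2"
  have \<rho>: "0 < \<rho>" "\<rho> < r" using assms by (auto simp: \<rho>_def double_powser_def)
  define Y where "Y = {fst p - \<rho>..fst p + \<rho>} \<times> {snd p - \<rho>..snd p + \<rho>}"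
  define F where "F = (\<lambda>z q. case z of (i, j) \<Rightarrow> a i j * (fst q - fst p) ^ i * (snd q - snd p) ^ j)"
  have "(\<lambda>(i, j). a i j * \<rho> ^ i * \<rho> ^ j) summable_on UNIV"
    using double_powser_summable[OF assms, of \<rho> \<rho>] \<rho> by simp
  then have s: "(\<lambda>x. \<bar>case x of (i, j) \<Rightarrow> a i j * \<rho> ^ i * \<rho> ^ j\<bar>) summable_on UNIV"
    by (rule iffD1[OF summable_on_iff_abs_summable_on_real, unfolded real_norm_def])
  have "uniform_limit Y (\<lambda>X y. \<Sum>x\<in>X. F x y) f (finite_subsets_at_top UNIV)"
  proof (rule Weierstrass_m_test_general'[OF _ _ s])
    fix z :: "nat \<times> nat" and q assume q: "q \<in> Y"
    obtain i j where z: "z = (i, j)" by force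
    have "\<bar>fst q - fst p\<bar> \<le> \<rho>" "\<bar>snd q - snd p\<bar> \<le> \<rho>"
      using q by (auto simp: Y_def)
    then show "norm (F z q) \<le> \<bar>case z of (i, j) \<Rightarrow> a i j * \<rho> ^ i * \<rho> ^ j\<bar>"
      using \<rho> by (auto simp: F_def z abs_mult power_abs intro!: mult_mono power_mono)
  next
    fix q assume q: "q \<in> Y"
    have "\<bar>fst q - fst p\<bar> < r" "\<bar>snd q - snd p\<bar> < r"
      using q \<rho> by (auto simp: Y_def)
    then show "((\<lambda>z. F z q) has_sum f q) UNIV"
      unfolding F_def by (rule double_powser_has_sum[OF assms])
  qed
  then have "continuous_on Y f"
  proof (rule uniform_limit_theorem[rotated])
    show "\<forall>\<^sub>F X in finite_subsets_at_top UNIV. continuous_on Y (\<lambda>y. \<Sum>x\<in>X. F x y)"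
      unfolding F_def case_prod_unfold by (intro always_eventually allI continuous_intros)
  qed simp
  moreover have "p \<in> interior Y"
  proof (rule interiorI)
    show "open ({fst p - \<rho><..<fst p + \<rho>} \<times> {snd p - \<rho><..<snd p + \<rho>})"
      by (intro open_Times) auto
    show "p \<in> {fst p - \<rho><..<fst p + \<rho>} \<times> {snd p - \<rho><..<snd p + \<rho>}"
      using \<rho> by (cases p) auto
  qed (auto simp: Y_def)
  ultimately show ?thesis by (rule continuous_on_interior)
qed

section \<open>Mixed partial derivatives of analytic functions\<close>

text \<open>The coefficients after \<open>j\<close> differentiations in the first variable and
  \<open>i\<close> in the second. The orders \<open>i j\<close> follow \<open>mixed_partial\<close>,
  with the time order first, while the exponents \<open>k l\<close> follow the pair, with space
  first.\<close>

definition mp_coeff :: "(nat \<Rightarrow> nat \<Rightarrow> real) \<Rightarrow> nat \<Rightarrow> nat \<Rightarrow> nat \<Rightarrow> nat \<Rightarrow> real" where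
  "mp_coeff a i j k l = fact (k + j) / fact k * (fact (l + i) / fact l) * a (k + j) (l + i)"

lemma mp_coeff_Suc:
  "mp_coeff a i (Suc j) = (\<lambda>k l. real (Suc k) * mp_coeff a i j (Suc k) l)"
  "mp_coeff a (Suc i) j = (\<lambda>k l. real (Suc l) * mp_coeff a i j k (Suc l))"
  by (auto simp: mp_coeff_def fun_eq_iff field_simps simp del: of_nat_Suc)

lemma mixed_partial_0_0: "mixed_partial 0 0 f = f"
  by (simp add: mixed_partial_def fun_eq_iff)

lemma mixed_partial_Suc_snd:
  "mixed_partial (Suc i) j f q = deriv (\<lambda>t. mixed_partial i j f (fst q, t)) (snd q)"
  by (simp add: mixed_partial_def)

lemma mixed_partial_Suc_fst:
  "mixed_partial 0 (Suc j) f q = deriv (\<lambda>x. mixed_partial 0 j f (x, snd q)) (fst q)"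
  by (simp add: mixed_partial_def)

lemma double_powser_mixed_partial:
  assumes "double_powser a r f p"
  shows "double_powser (mp_coeff a i j) r (mixed_partial i j f) p"
proof (induction i)
  case 0
  show ?case
  proof (induction j)
    case 0
    have "mp_coeff a 0 0 = a" by (simp add: mp_coeff_def fun_eq_iff)
    then show ?case using assms by (simp add: mixed_partial_0_0)
  next
    case (Suc j)
    then show ?case
      using double_powser_deriv_fst(1)[OF Suc] by (simp only: mp_coeff_Suc mixed_partial_Suc_fst[abs_def])
  qed
next
  case (Suc i)
  then show ?case
    using double_powser_deriv_snd(1)[OF Suc] by (simp only: mp_coeff_Suc mixed_partial_Suc_snd[abs_def])
qed

text \<open>Both values are the constant coefficient. This serves to interchange derivatives: two
  orders of differentiation that lead to the same coefficients have the same value.\<close>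

lemma double_powser_unique:
  assumes "double_powser a r f p" "double_powser a r g p"
  shows "f p = g p"
proof -
  have "((\<lambda>(i, j). a i j * 0 ^ i * 0 ^ j) has_sum f p) UNIV" "((\<lambda>(i, j). a i j * 0 ^ i * 0 ^ j) has_sum g p) UNIV"
    using assms unfolding double_powser_def by (auto dest!: spec[of _ 0])
  then show ?thesis by (rule has_sum_unique)
qed

lemma analytic_double_powser:
  assumes "real_analytic2_on f UNIV"
  obtains a r where "double_powser a r f p"
  using assms unfolding real_analytic2_on_def real_analytic2_at_def double_powser_def by blast

lemma mixed_partial_deriv_snd:
  assumes "real_analytic2_on f UNIV"
  shows "((\<lambda>t. mixed_partial i j f (x, t)) has_real_derivative mixed_partial (Suc i) j f (x, t)) (at t)"
proof -
  obtain a r where d: "double_powser a r f (x, t)" using analytic_double_powser[OF assms] by blast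
  then show ?thesis
    using double_powser_deriv_snd(2)[OF double_powser_mixed_partial[OF d], of 0 0]
    by (simp add: mixed_partial_Suc_snd double_powser_def)
qed

text \<open>In \<open>mixed_partial\<close> the space derivatives are innermost, so a further outer
  space derivative has to be moved past the time derivatives. Comparing coefficients through
  \<open>mp_coeff_Suc\<close> does this.\<close>

lemma mixed_partial_deriv_fst:
  assumes "real_analytic2_on f UNIV"
  shows "((\<lambda>x. mixed_partial i j f (x, t)) has_real_derivative mixed_partial i (Suc j) f (x, t)) (at x)"
proof -
  obtain a r where d: "double_powser a r f (x, t)" using analytic_double_powser[OF assms] by blast
  have "mixed_partial i (Suc j) f (x, t) = deriv (\<lambda>x. mixed_partial i j f (x, t)) x"
    using double_powser_unique[OF double_powser_mixed_partial[OF d, of i "Suc j"]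
      double_powser_deriv_fst(1)[OF double_powser_mixed_partial[OF d, of i j], folded mp_coeff_Suc]] by simp
  then show ?thesis
    using double_powser_deriv_fst(2)[OF double_powser_mixed_partial[OF d], of 0 0] d
    by (simp add: double_powser_def)
qed

lemma continuous_on_mixed_partial:
  assumes "real_analytic2_on f UNIV"
  shows "continuous_on A (mixed_partial i j f)"
  by (metis analytic_double_powser[OF assms] double_powser_mixed_partial isCont_double_powser continuous_at_imp_continuous_on)

section \<open>Cauchy estimates for mixed partial derivatives\<close>

lemma fact_quotient_le: "fact (k + j) / fact k \<le> (2 ^ (k + j) * fact j :: real)"
  using fact_add_le[of k j] by (simp add: divide_simps mult_ac)

lemma mixed_partial_bound_local:
  assumes "real_analytic2_on f UNIV"
  shows "\<exists>\<delta> C R. \<delta> > 0 \<and> C \<ge> 0 \<and> R \<ge> 1 \<and>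
    (\<forall>q i j. dist q p < \<delta> \<longrightarrow> \<bar>mixed_partial i j f q\<bar> \<le> C * R ^ (i + j) * fact i * fact j)"
proof -
  obtain a r where d: "double_powser a r f p" using analytic_double_powser[OF assms] by blast
  define \<rho> where "\<rho> = r / 2"
  have \<rho>: "0 < \<rho>" "\<rho> < r" using d by (auto simp: \<rho>_def double_powser_def)
  obtain A where A: "A \<ge> 0" "\<And>i j. \<bar>a i j\<bar> \<le> A / \<rho> ^ (i + j)"
    using double_powser_coeff_bound[OF d \<rho>] by blast
  \<comment> \<open>Within distance \<open>\<rho> / 4\<close> the powers of 2 from the factorial
    quotients meet powers of 1/4, so the series is dominated by a double geometric series of ratio
    1/2 and sum 4. The maximum with 1 makes powers of the radius constant increase with the
    exponent.\<close>
  have "\<bar>mixed_partial i j f q\<bar> \<le> 4 * A * (max 1 (2 / \<rho>)) ^ (i + j) * fact i * fact j" if q: "dist q p < \<rho> / 4" for q i j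
  proof -
    define u where "u = fst q - fst p"
    define v where "v = snd q - snd p"
    have uv: "\<bar>u\<bar> < \<rho> / 4" "\<bar>v\<bar> < \<rho> / 4"
      using q dist_fst_le[of q p] dist_snd_le[of q p] by (auto simp: u_def v_def dist_real_def)
    have hs: "((\<lambda>(k, l). mp_coeff a i j k l * u ^ k * v ^ l) has_sum mixed_partial i j f q) UNIV"
      using double_powser_has_sum[OF double_powser_mixed_partial[OF d], of q i j] uv \<rho> unfolding u_def v_def by simp
    define M where "M = A * (2 / \<rho>) ^ (i + j) * fact i * fact j"
    have g: "((\<lambda>k. (1/2::real) ^ k) has_sum 2) UNIV"
      using has_sum_geometric[of "1/2"] by simp
    have g2: "((\<lambda>(k, l). (1/2::real) ^ k * (1/2) ^ l) has_sum 4) UNIV"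
      using has_sum_prod[OF _ _ g g] by simp
    have "((\<lambda>z. M * (case z of (k, l) \<Rightarrow> (1/2::real) ^ k * (1/2) ^ l)) has_sum M * 4) UNIV"
      by (rule has_sum_cmult_right[OF g2])
    then have "\<bar>mixed_partial i j f q\<bar> \<le> M * 4"
    proof (rule abs_has_sum_le[OF hs, rotated], clarify)
      fix k l :: nat
      have ar: "\<bar>a (k + j) (l + i)\<bar> \<le> A / \<rho> ^ (k + j + (l + i))" by (rule A)
      have "\<bar>mp_coeff a i j k l * u ^ k * v ^ l\<bar>
        = (fact (k + j) / fact k) * (fact (l + i) / fact l) * \<bar>a (k + j) (l + i)\<bar> * \<bar>u\<bar> ^ k * \<bar>v\<bar> ^ l"
        by (simp add: mp_coeff_def abs_mult power_abs)
      also have "\<dots> \<le> (2 ^ (k + j) * fact j) * (2 ^ (l + i) * fact i) * (A / \<rho> ^ (k + j + (l + i)))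
          * (\<rho> / 4) ^ k * (\<rho> / 4) ^ l"
        using uv \<rho> A(1) by (intro mult_mono fact_quotient_le ar power_mono mult_nonneg_nonneg) auto
      also have "\<dots> = M * ((2 ^ k / 4 ^ k) * (2 ^ l / 4 ^ l))"
        using \<rho> by (simp add: M_def power_add field_simps)
      also have "\<dots> = M * ((1/2) ^ k * (1/2) ^ l)"
        by (simp add: power_divide[symmetric])
      finally show "\<bar>mp_coeff a i j k l * u ^ k * v ^ l\<bar> \<le> M * ((1/2) ^ k * (1/2) ^ l)" .
    qed
    also have "M * 4 \<le> 4 * A * (max 1 (2 / \<rho>)) ^ (i + j) * fact i * fact j"
    proof -
      have "(2 / \<rho>) ^ (i + j) \<le> (max 1 (2 / \<rho>)) ^ (i + j)"
        using \<rho> by (intro power_mono) auto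
      then have "A * (2 / \<rho>) ^ (i + j) * fact i * fact j \<le> A * (max 1 (2 / \<rho>)) ^ (i + j) * fact i * fact j"
        using A by (intro mult_right_mono mult_left_mono) auto
      then show ?thesis unfolding M_def by (simp only: mult.commute[of _ 4] mult.assoc mult_le_cancel_left_pos zero_less_numeral)
    qed
    finally show ?thesis .
  qed
  then show ?thesis
    using A \<rho> by (intro exI[of _ "\<rho> / 4"] exI[of _ "4 * A"] exI[of _ "max 1 (2 / \<rho>)"]) auto
qed

lemma mixed_partial_bound_compact:
  assumes "real_analytic2_on f UNIV" and "compact K"
  obtains C R where "C \<ge> 0" "R \<ge> 1"
    "\<And>q i j. q \<in> K \<Longrightarrow> \<bar>mixed_partial i j f q\<bar> \<le> C * R ^ (i + j) * fact i * fact j"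
proof -
  obtain \<delta> C R where l: "\<And>p. \<delta> p > 0 \<and> C p \<ge> 0 \<and> R p \<ge> 1 \<and>
    (\<forall>q i j. dist q p < \<delta> p \<longrightarrow> \<bar>mixed_partial i j f q\<bar> \<le> C p * R p ^ (i + j) * fact i * fact j)"
    using mixed_partial_bound_local[OF assms(1)] by metis
  have "K \<subseteq> (\<Union>p\<in>K. ball p (\<delta> p))"
    using l by auto
  then obtain F where F: "F \<subseteq> K" "finite F" "K \<subseteq> (\<Union>p\<in>F. ball p (\<delta> p))"
    using compactE_image[OF assms(2), of K "\<lambda>p. ball p (\<delta> p)"] by auto
  \<comment> \<open>Over the finite subcover, sums dominate every single constant and also make
    sense for an empty cover; the added 1 in \<open>R'\<close> keeps it at least 1 in that
    case.\<close>
  define C' where "C' = sum C F"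
  define R' where "R' = 1 + sum R F"
  have C0: "C p \<ge> 0" and R1: "R p \<ge> 1" for p
    using l[of p] by auto
  then have R0: "R p \<ge> 0" for p
    by (meson order_trans zero_le_one)
  have "C' \<ge> 0" "R' \<ge> 1"
    using C0 R0 by (auto simp: C'_def R'_def sum_nonneg)
  moreover have "\<bar>mixed_partial i j f q\<bar> \<le> C' * R' ^ (i + j) * fact i * fact j" if "q \<in> K" for q i j
  proof -
    have "q \<in> (\<Union>p\<in>F. ball p (\<delta> p))" using F(3) that by blast
    then obtain p where p: "p \<in> F" "dist q p < \<delta> p"
      by (auto simp: dist_commute)
    have "C p \<le> C'" unfolding C'_def using F(2) p(1) C0 by (intro member_le_sum) auto
    moreover have "R p \<le> R'" unfolding R'_def using member_le_sum[of p F R] F(2) p(1) R0 by auto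
    ultimately have "C p * R p ^ (i + j) * fact i * fact j \<le> C' * R' ^ (i + j) * fact i * fact j"
      using C0[of p] R0[of p] by (intro mult_right_mono mult_mono power_mono) auto
    then show ?thesis using l[of p] p(2) by (meson order_trans)
  qed
  ultimately show ?thesis using that by blast
qed

section \<open>Integrals along characteristics\<close>

text \<open>Duhamel's formula for the transport equation with source \<open>K\<close>, speed
  \<open>- \<sigma>\<close> and zero initial values.\<close>

definition char_integral :: "real \<Rightarrow> (real \<times> real \<Rightarrow> real) \<Rightarrow> real \<times> real \<Rightarrow> real" where
  "char_integral \<sigma> K = (\<lambda>(x, \<theta>). integral {0..\<theta>} (\<lambda>s. K (x + \<sigma> * (\<theta> - s), s)))"

text \<open>Treating \<open>x + \<sigma> * \<theta>\<close> as an independent variable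
  \<open>y\<close> removes \<open>\<theta>\<close> from the integrand, which leaves a
  differentiation under the integral sign.\<close>

lemma char_integral_aux_deriv:
  fixes K K' :: "real \<times> real \<Rightarrow> real"
  assumes "continuous_on UNIV K" "continuous_on UNIV K'"
    and "\<And>x t. ((\<lambda>x. K (x, t)) has_real_derivative K' (x, t)) (at x)"
  shows "((\<lambda>y. integral {0..\<theta>} (\<lambda>s. K (y - \<sigma> * s, s))) has_real_derivative
    integral {0..\<theta>} (\<lambda>s. K' (y - \<sigma> * s, s))) (at y)"
proof -
  have "((\<lambda>y. integral (cbox 0 \<theta>) (\<lambda>s. K (y - \<sigma> * s, s))) has_real_derivative
      integral (cbox 0 \<theta>) (\<lambda>s. K' (y - \<sigma> * s, s))) (at y within UNIV)"
  proof (rule leibniz_rule_field_derivative)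
    show "((\<lambda>y. K (y - \<sigma> * t, t)) has_real_derivative K' (y - \<sigma> * t, t)) (at y within UNIV)" for y t
      using DERIV_chain2[OF assms(3), of "\<lambda>y. y - \<sigma> * t" 1 y UNIV t]
      by (simp add: DERIV_diff[OF DERIV_ident DERIV_const, simplified])
    show "(\<lambda>s. K (y - \<sigma> * s, s)) integrable_on cbox 0 \<theta>" for y
      by (intro integrable_continuous continuous_on_compose2[OF assms(1)] continuous_intros) auto
    show "continuous_on (UNIV \<times> cbox 0 \<theta>) (\<lambda>(y, s). K' (y - \<sigma> * s, s))"
      unfolding case_prod_unfold
      by (intro continuous_on_compose2[OF assms(2)] continuous_intros) auto
  qed auto
  then show ?thesis by simp
qed

lemma char_integral_deriv_fst:
  fixes K K' :: "real \<times> real \<Rightarrow> real"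
  assumes "continuous_on UNIV K" "continuous_on UNIV K'"
    and "\<And>x t. ((\<lambda>x. K (x, t)) has_real_derivative K' (x, t)) (at x)"
  shows "((\<lambda>x. char_integral \<sigma> K (x, \<theta>)) has_real_derivative char_integral \<sigma> K' (x, \<theta>)) (at x)"
proof -
  have "((\<lambda>x. integral {0..\<theta>} (\<lambda>s. K ((x + \<sigma> * \<theta>) - \<sigma> * s, s))) has_real_derivative
    integral {0..\<theta>} (\<lambda>s. K' ((x + \<sigma> * \<theta>) - \<sigma> * s, s)) * 1) (at x)"
    by (rule DERIV_chain2[OF char_integral_aux_deriv[OF assms]]) (auto intro!: derivative_eq_intros)
  then show ?thesis by (simp add: char_integral_def algebra_simps)
qed

text \<open>
  \<open>char_integral \<sigma> K\<close> is a function of \<open>y = x + \<sigma> \<theta>\<close> and \<open>\<theta>\<close> whose partial \<open>\<theta>\<close>-derivative is given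
  by the fundamental theorem of calculus; the chain rule then gives the total \<open>\<theta>\<close>-derivative.
\<close>

lemma char_integral_deriv_snd:
  fixes K K' :: "real \<times> real \<Rightarrow> real"
  assumes "continuous_on UNIV K" "continuous_on UNIV K'"
    and "\<And>x t. ((\<lambda>x. K (x, t)) has_real_derivative K' (x, t)) (at x)"
    and "\<theta> \<in> {0..T}"
  shows "((\<lambda>\<theta>. char_integral \<sigma> K (x, \<theta>)) has_real_derivative
    K (x, \<theta>) + \<sigma> * char_integral \<sigma> K' (x, \<theta>)) (at \<theta> within {0..T})"
proof -
  define V where "V = (\<lambda>y \<theta>. integral {0..\<theta>} (\<lambda>s. K (y - \<sigma> * s, s)))"
  define V' where "V' = (\<lambda>y \<theta>. integral {0..\<theta>} (\<lambda>s. K' (y - \<sigma> * s, s)))"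
  define y where "y = x + \<sigma> * \<theta>"
  have 1: "((\<lambda>y. V y \<theta>) has_derivative (\<lambda>h. V' y \<theta> * h)) (at y within UNIV)"
    using char_integral_aux_deriv[OF assms(1-3), of \<theta> \<sigma> y]
    by (simp add: V_def V'_def has_field_derivative_def)
  have 2: "((\<lambda>t. V z t) has_derivative blinfun_mult_right (K (z - \<sigma> * t, t))) (at t within {0..T})"
    if "t \<in> {0..T}" for z t
  proof -
    have "continuous_on {0..T} (\<lambda>s. K (z - \<sigma> * s, s))"
      by (intro continuous_on_compose2[OF assms(1)] continuous_intros) auto
    from integral_has_real_derivative[OF this that] show ?thesis
      by (simp add: V_def has_field_derivative_def)
  qed
  \<comment> \<open>Joint differentiability of \<open>V\<close> follows from its two partial
    derivatives once one of them is continuous at the point. That continuity is stated for bounded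
    linear maps, hence \<open>blinfun_mult_right\<close>.\<close>
  have 3: "continuous (at (y, \<theta>) within UNIV \<times> {0..T}) (\<lambda>(z, t). blinfun_mult_right (K (z - \<sigma> * t, t)))"
  proof -
    have "continuous_on UNIV (\<lambda>q. blinfun_mult_right (K (fst q - \<sigma> * snd q, snd q)))"
      by (intro bounded_linear.continuous_on[OF bounded_linear_blinfun_mult_right]
        continuous_on_compose2[OF assms(1)] continuous_intros) auto
    then have "isCont (\<lambda>q. blinfun_mult_right (K (fst q - \<sigma> * snd q, snd q))) (y, \<theta>)"
      by (simp add: continuous_on_eq_continuous_at)
    then show ?thesis
      unfolding case_prod_unfold by (rule continuous_at_imp_continuous_at_within)
  qed
  have 4: "((\<lambda>(z, t). V z t) has_derivative (\<lambda>(h, k). V' y \<theta> * h + blinfun_mult_right (K (y - \<sigma> * \<theta>, \<theta>)) k))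
    (at (y, \<theta>) within UNIV \<times> {0..T})"
    by (rule has_derivative_partialsI[OF 1 2 3]) (use assms(4) in auto)
  have 5: "((\<lambda>t. (x + \<sigma> * t, t)) has_derivative (\<lambda>h. (\<sigma> * h, h))) (at \<theta> within {0..T})"
    by (auto intro!: derivative_eq_intros)
  have "((\<lambda>t. (\<lambda>(z, t). V z t) (x + \<sigma> * t, t)) has_derivative
    (\<lambda>h. (\<lambda>(h, k). V' y \<theta> * h + blinfun_mult_right (K (y - \<sigma> * \<theta>, \<theta>)) k) (\<sigma> * h, h))) (at \<theta> within {0..T})"
    by (rule has_derivative_in_compose[OF 5 has_derivative_subset[OF 4[unfolded y_def]], folded y_def]) auto
  moreover have "char_integral \<sigma> K (x, t) = V (x + \<sigma> * t) t" "char_integral \<sigma> K' (x, t) = V' (x + \<sigma> * t) t" for t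
    by (simp_all add: char_integral_def V_def V'_def algebra_simps)
  moreover have "(\<lambda>h. V' y \<theta> * (\<sigma> * h) + K (y - \<sigma> * \<theta>, \<theta>) * h) = (*) (K (x, \<theta>) + \<sigma> * V' y \<theta>)"
    by (auto simp: y_def algebra_simps)
  ultimately show ?thesis
    by (simp add: has_field_derivative_def y_def)
qed

lemma char_integral_bound:
  fixes K :: "real \<times> real \<Rightarrow> real"
  assumes "continuous_on UNIV K" "0 \<le> \<theta>"
    and "\<And>s. s \<in> {0..\<theta>} \<Longrightarrow> \<bar>K (x + \<sigma> * (\<theta> - s), s)\<bar> \<le> B"
  shows "\<bar>char_integral \<sigma> K (x, \<theta>)\<bar> \<le> B * \<theta>"
proof -
  have "norm (integral {0..\<theta>} (\<lambda>s. K (x + \<sigma> * (\<theta> - s), s))) \<le> B * (\<theta> - 0)"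
    using assms by (intro integral_bound continuous_on_compose2[OF assms(1)] continuous_intros) auto
  then show ?thesis by (simp add: char_integral_def)
qed

section \<open>Identification of the series\<close>

text \<open>
  \<open>char_deriv J \<sigma> x k\<close> is the \<open>k\<close>-th derivative of \<open>\<lambda>\<theta>. char_integral \<sigma> J (x, \<theta>)\<close>, obtained by
  iterating \<open>\<partial>\<^sub>\<theta> W = J + \<sigma> \<partial>\<^sub>x W\<close>.
\<close>

definition char_deriv :: "(real \<times> real \<Rightarrow> real) \<Rightarrow> real \<Rightarrow> real \<Rightarrow> nat \<Rightarrow> real \<Rightarrow> real" where
  "char_deriv J \<sigma> x k \<theta> = \<sigma> ^ k * char_integral \<sigma> (mixed_partial 0 k J) (x, \<theta>)
     + (\<Sum>j<k. \<sigma> ^ j * mixed_partial (k - 1 - j) j J (x, \<theta>))"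

lemma char_deriv_has_derivative:
  assumes J: "real_analytic2_on J UNIV" and \<theta>: "\<theta> \<in> {0..T}"
  shows "(char_deriv J \<sigma> x k has_real_derivative char_deriv J \<sigma> x (Suc k) \<theta>) (at \<theta> within {0..T})"
proof -
  note W = char_integral_deriv_snd[OF continuous_on_mixed_partial[OF J] continuous_on_mixed_partial[OF J]
      mixed_partial_deriv_fst[OF J] \<theta>]
  note D = DERIV_subset[OF mixed_partial_deriv_snd[OF J] subset_UNIV]
  have "(char_deriv J \<sigma> x k has_real_derivative
      \<sigma> ^ k * (mixed_partial 0 k J (x, \<theta>) + \<sigma> * char_integral \<sigma> (mixed_partial 0 (Suc k) J) (x, \<theta>))
      + (\<Sum>j<k. \<sigma> ^ j * mixed_partial (Suc (k - 1 - j)) j J (x, \<theta>))) (at \<theta> within {0..T})"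
    unfolding char_deriv_def[abs_def]
    by (intro DERIV_add DERIV_cmult W DERIV_sum D)
  \<comment> \<open>The sum for \<open>Suc k\<close> has one more summand, \<open>j = k\<close>; it
    is the boundary term \<open>mixed_partial 0 k J\<close> produced by differentiating the
    integral.\<close>
  moreover have "(\<Sum>j<k. \<sigma> ^ j * mixed_partial (Suc (k - 1 - j)) j J (x, \<theta>))
      = (\<Sum>j<k. \<sigma> ^ j * mixed_partial (k - j) j J (x, \<theta>))"
    by (intro sum.cong) (auto simp: Suc_diff_Suc)
  ultimately show ?thesis by (simp add: char_deriv_def algebra_simps)
qed

lemma char_deriv_bound:
  assumes J: "real_analytic2_on J UNIV" and T: "0 \<le> T" and \<sigma>: "\<bar>\<sigma>\<bar> = 1"
  obtains C R where "C \<ge> 0" "R \<ge> 1"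
    "\<And>k \<theta>. \<theta> \<in> {0..T} \<Longrightarrow> \<bar>char_deriv J \<sigma> x k \<theta>\<bar> \<le> C * R ^ k * fact k"
proof -
  \<comment> \<open>Since \<open>\<sigma>\<close> has absolute value 1, the characteristics through
    \<open>(x, \<theta>)\<close> traced back to time 0 stay in this rectangle.\<close>
  have "compact ({x - T..x + T} \<times> {0..T})" by (intro compact_Times compact_Icc)
  then obtain C R where C: "C \<ge> 0" and R: "R \<ge> 1" and
    bd: "\<And>q i j. q \<in> {x - T..x + T} \<times> {0..T} \<Longrightarrow> \<bar>mixed_partial i j J q\<bar> \<le> C * R ^ (i + j) * fact i * fact j"
    using mixed_partial_bound_compact[OF J] by metis
  have "\<bar>char_deriv J \<sigma> x k \<theta>\<bar> \<le> (C * (T + 1)) * R ^ k * fact k" if \<theta>: "\<theta> \<in> {0..T}" for k \<theta>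
  proof -
    have 1: "\<bar>char_integral \<sigma> (mixed_partial 0 k J) (x, \<theta>)\<bar> \<le> C * R ^ k * fact k * \<theta>"
    proof (rule char_integral_bound[OF continuous_on_mixed_partial[OF J]])
      fix s assume s: "s \<in> {0..\<theta>}"
      have "\<bar>\<sigma> * (\<theta> - s)\<bar> \<le> T" using s \<theta> \<sigma> by (simp add: abs_mult)
      then have "(x + \<sigma> * (\<theta> - s), s) \<in> {x - T..x + T} \<times> {0..T}" using s \<theta> by auto
      from bd[OF this, of 0 k] show "\<bar>mixed_partial 0 k J (x + \<sigma> * (\<theta> - s), s)\<bar> \<le> C * R ^ k * fact k"
        by simp
    qed (use \<theta> in auto)
    also have "\<dots> \<le> C * R ^ k * fact k * T" using \<theta> C R by (intro mult_left_mono) auto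
    finally have 1: "\<bar>\<sigma> ^ k * char_integral \<sigma> (mixed_partial 0 k J) (x, \<theta>)\<bar> \<le> C * R ^ k * fact k * T"
      using \<sigma> by (simp add: abs_mult power_abs)
    have "\<bar>\<Sum>j<k. \<sigma> ^ j * mixed_partial (k - 1 - j) j J (x, \<theta>)\<bar>
        \<le> (\<Sum>j<k. C * R ^ k * fact (k - 1))"
    proof (rule order_trans[OF sum_abs sum_mono])
      fix j assume j: "j \<in> {..<k}"
      \<comment> \<open>A product of two factorials is at most the factorial of the sum, so the
        \<open>k\<close> summands together cost at most \<open>k\<close> times
        \<open>fact (k - 1)\<close>.\<close>
      have f: "fact (k - 1 - j) * fact j \<le> (fact (k - 1) :: real)"
      proof -
        have "fact (k - 1 - j) * fact j \<le> (fact (k - 1) :: nat)"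
          using fact_fact_dvd_fact[of "k - 1 - j" j, where 'a = nat] j by (intro dvd_imp_le) auto
        then have "real (fact (k - 1 - j) * fact j) \<le> real (fact (k - 1))"
          by (simp only: of_nat_le_iff)
        then show ?thesis by simp
      qed
      have "\<bar>\<sigma> ^ j * mixed_partial (k - 1 - j) j J (x, \<theta>)\<bar> = \<bar>mixed_partial (k - 1 - j) j J (x, \<theta>)\<bar>"
        using \<sigma> by (simp add: abs_mult power_abs)
      also have "\<dots> \<le> C * R ^ (k - 1 - j + j) * fact (k - 1 - j) * fact j"
        by (rule bd) (use \<theta> T in auto)
      also have "\<dots> = C * R ^ (k - 1 - j + j) * (fact (k - 1 - j) * fact j)"
        by (simp only: mult.assoc)
      also have "\<dots> \<le> C * R ^ k * fact (k - 1)"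
        using C R j f by (intro mult_mono power_increasing) auto
      finally show "\<bar>\<sigma> ^ j * mixed_partial (k - 1 - j) j J (x, \<theta>)\<bar> \<le> C * R ^ k * fact (k - 1)" .
    qed
    also have "\<dots> = C * R ^ k * (real k * fact (k - 1))" by simp
    \<comment> \<open>For \<open>k = 0\<close> the left-hand side is 0; for positive
      \<open>k\<close> equality holds.\<close>
    also have "\<dots> \<le> C * R ^ k * fact k" using C R by (cases k) auto
    finally show ?thesis
      using 1 unfolding char_deriv_def by (simp add: algebra_simps)
  qed
  then show ?thesis using that[of "C * (T + 1)" R] C R T by auto
qed

lemma char_deriv_0: "char_deriv J \<sigma> x k 0 = (\<Sum>j<k. \<sigma> ^ j * mixed_partial (k - 1 - j) j J (x, 0))"
  by (simp add: char_deriv_def char_integral_def)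

section \<open>Separation of even and odd orders\<close>

lemma sum_parity_split:
  fixes g :: "nat \<Rightarrow> real"
  shows "(\<Sum>j<2 * n. g j) = (\<Sum>m<n. g (2 * m)) + (\<Sum>m<n. g (2 * m + 1))"
    and "(\<Sum>j<2 * n. (- 1) ^ j * g j) = (\<Sum>m<n. g (2 * m)) - (\<Sum>m<n. g (2 * m + 1))"
  by (induction n) simp_all

text \<open>The alternating signs cancel the even indices and double the odd ones. The two forms
  serve the even and the odd powers of \<open>\<theta>\<close> in \<open>Hy\<close>; the factor
  \<open>1 ^ j\<close> matches \<open>char_deriv_0\<close> at \<open>\<sigma> = 1\<close>.\<close>

lemma sum_odd_part:
  fixes g :: "nat \<Rightarrow> real"
  shows "(\<Sum>j<2 * n + 2. 1 ^ j * g j) - (\<Sum>j<2 * n + 2. (- 1) ^ j * g j) = 2 * (\<Sum>m=0..n. g (2 * m + 1))"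
    and "(\<Sum>j<2 * n + 3. 1 ^ j * g j) - (\<Sum>j<2 * n + 3. (- 1) ^ j * g j) = 2 * (\<Sum>m=0..n. g (2 * m + 1))"
proof -
  have eq: "2 * n + 2 = 2 * Suc n" "2 * n + 3 = Suc (2 * Suc n)" "{0..n} = {..<Suc n}" by auto
  show "(\<Sum>j<2 * n + 2. 1 ^ j * g j) - (\<Sum>j<2 * n + 2. (- 1) ^ j * g j) = 2 * (\<Sum>m=0..n. g (2 * m + 1))"
    unfolding eq power_one mult_1 sum_parity_split by (simp add: sum_negf)
  show "(\<Sum>j<2 * n + 3. 1 ^ j * g j) - (\<Sum>j<2 * n + 3. (- 1) ^ j * g j) = 2 * (\<Sum>m=0..n. g (2 * m + 1))"
    unfolding eq power_one mult_1 sum.lessThan_Suc[of _ "2 * Suc n"] sum_parity_split by (simp add: sum_negf)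
qed

lemma sum_even_part:
  fixes g :: "nat \<Rightarrow> real"
  shows "(\<Sum>j<2 * n + 1. 1 ^ j * g j) + (\<Sum>j<2 * n + 1. (- 1) ^ j * g j) = 2 * (\<Sum>m=0..n. g (2 * m))"
    and "(\<Sum>j<2 * n + 2. 1 ^ j * g j) + (\<Sum>j<2 * n + 2. (- 1) ^ j * g j) = 2 * (\<Sum>m=0..n. g (2 * m))"
proof -
  have eq: "2 * n + 1 = Suc (2 * n)" "2 * n + 2 = 2 * Suc n" "{0..n} = {..<Suc n}" by auto
  show "(\<Sum>j<2 * n + 1. 1 ^ j * g j) + (\<Sum>j<2 * n + 1. (- 1) ^ j * g j) = 2 * (\<Sum>m=0..n. g (2 * m))"
    unfolding eq power_one mult_1 sum.lessThan_Suc sum_parity_split by (simp add: sum_negf)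
  show "(\<Sum>j<2 * n + 2. 1 ^ j * g j) + (\<Sum>j<2 * n + 2. (- 1) ^ j * g j) = 2 * (\<Sum>m=0..n. g (2 * m))"
    unfolding eq power_one mult_1 sum_parity_split by (simp add: sum_negf)
qed

text \<open>The given formulas sum even and odd powers of \<open>\<theta>\<close> separately, while
  Taylor's series is a single one; this interleaves them.\<close>

lemma sums_even_odd:
  fixes c :: "nat \<Rightarrow> real"
  assumes "(\<lambda>n. c (2 * n)) sums a" "(\<lambda>n. c (2 * n + 1)) sums b"
  shows "c sums (a + b)"
proof -
  have "(\<lambda>n. if even n then c (2 * (n div 2)) else c (2 * ((n - 1) div 2) + 1)) sums (b + a)"
    by (rule sums_if[OF assms(2,1)])
  moreover have "(\<lambda>n. if even n then c (2 * (n div 2)) else c (2 * ((n - 1) div 2) + 1)) = c"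
    by (auto simp: fun_eq_iff elim!: oddE)
  ultimately show ?thesis by (simp add: add.commute)
qed

text \<open>Convergence is known only for the combination that gives \<open>Hy\<close> or
  \<open>Ez\<close>, so the two characteristic integrals cannot be expanded one at a time. Their
  factorial bounds, however, add up.\<close>

lemma char_deriv_combination_sums:
  assumes J: "real_analytic2_on J UNIV" and T: "0 < T"
    and f: "\<And>k \<theta>. f k \<theta> = \<alpha> * char_deriv J 1 x k \<theta> + \<beta> * char_deriv J (- 1) x k \<theta>"
    and sm: "summable (\<lambda>k. f k 0 / fact k * T ^ k)"
    and \<theta>: "\<theta> \<in> {0..T}"
  shows "(\<lambda>k. f k 0 / fact k * \<theta> ^ k) sums f 0 \<theta>"
proof -
  obtain C R where 1: "C \<ge> 0" "R \<ge> 1"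
    "\<And>k \<theta>. \<theta> \<in> {0..T} \<Longrightarrow> \<bar>char_deriv J 1 x k \<theta>\<bar> \<le> C * R ^ k * fact k"
    using char_deriv_bound[OF J, of T 1 x] T by (metis abs_one less_imp_le)
  obtain C' R' where 2: "C' \<ge> 0" "R' \<ge> 1"
    "\<And>k \<theta>. \<theta> \<in> {0..T} \<Longrightarrow> \<bar>char_deriv J (- 1) x k \<theta>\<bar> \<le> C' * R' ^ k * fact k"
    using char_deriv_bound[OF J, of T "- 1" x] T by (metis abs_one abs_minus_cancel less_imp_le)
  show ?thesis
  proof (rule taylor_sums_of_factorial_bound[of T f, OF T _ _ _ sm \<theta>])
    show "(f k has_real_derivative f (Suc k) t) (at t within {0..T})" if "t \<in> {0..T}" for k t
      unfolding f[abs_def] by (intro DERIV_add DERIV_cmult char_deriv_has_derivative[OF J that])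
    show "\<bar>f k t\<bar> \<le> (\<bar>\<alpha>\<bar> * C + \<bar>\<beta>\<bar> * C') * max R R' ^ k * fact k" if t: "t \<in> {0..T}" for k t
    proof -
      have "\<bar>f k t\<bar> \<le> \<bar>\<alpha>\<bar> * \<bar>char_deriv J 1 x k t\<bar> + \<bar>\<beta>\<bar> * \<bar>char_deriv J (- 1) x k t\<bar>"
        unfolding f abs_mult[symmetric] by (rule abs_triangle_ineq)
      also have "\<dots> \<le> \<bar>\<alpha>\<bar> * (C * max R R' ^ k * fact k) + \<bar>\<beta>\<bar> * (C' * max R R' ^ k * fact k)"
      proof (intro add_mono mult_left_mono)
        show "\<bar>char_deriv J 1 x k t\<bar> \<le> C * max R R' ^ k * fact k"
          by (rule order_trans[OF 1(3)[OF t]]) (use 1 in \<open>auto intro!: mult_right_mono mult_left_mono power_mono\<close>)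
        show "\<bar>char_deriv J (- 1) x k t\<bar> \<le> C' * max R R' ^ k * fact k"
          by (rule order_trans[OF 2(3)[OF t]]) (use 2 in \<open>auto intro!: mult_right_mono mult_left_mono power_mono\<close>)
      qed auto
      finally show ?thesis by (simp add: algebra_simps)
    qed
    show "max R R' > 0" using 1 by auto
  qed
qed

lemma Hy_eq_char_integrals:
  assumes J: "real_analytic2_on J UNIV" and T: "0 < T" and \<theta>: "\<theta> \<in> {0..T}"
    and sm: "\<And>t. t \<in> {0..T} \<Longrightarrow> summable (Hy_even_term J x t) \<and> summable (Hy_odd_term J x t)"
  shows "Hy J (x, \<theta>) = - (char_integral 1 J (x, \<theta>) - char_integral (- 1) J (x, \<theta>)) / 2"
proof -
  define f where "f k t = (- 1 / 2) * char_deriv J 1 x k t + (1 / 2) * char_deriv J (- 1) x k t" for k t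
  have f0: "f k 0 = - ((\<Sum>j<k. 1 ^ j * mixed_partial (k - 1 - j) j J (x, 0))
      - (\<Sum>j<k. (- 1) ^ j * mixed_partial (k - 1 - j) j J (x, 0))) / 2" for k
    unfolding f_def char_deriv_0 by simp
  have sums: "(\<lambda>k. f k 0 / fact k * t ^ k) sums Hy J (x, t)" if "t \<in> {0..T}" for t
  proof -
    define c where "c k = f k 0 / fact k * t ^ k" for k
    have "c (2 * n + 2) = - Hy_even_term J x t n" for n
    proof -
      have "f (2 * n + 2) 0 = - (\<Sum>m=0..n. mixed_partial (2 * n + 2 - 1 - (2 * m + 1)) (2 * m + 1) J (x, 0))"
        unfolding f0 sum_odd_part(1)[of "\<lambda>j. mixed_partial (2 * n + 2 - 1 - j) j J (x, 0)" n] by simp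
      also have "\<dots> = - (\<Sum>m=0..n. mixed_partial (2 * (n - m)) (2 * m + 1) J (x, 0))"
        by (simp add: right_diff_distrib')
      finally show ?thesis by (simp add: c_def Hy_even_term_def)
    qed
    moreover have "c (2 * n + 3) = - Hy_odd_term J x t n" for n
    proof -
      have "f (2 * n + 3) 0 = - (\<Sum>m=0..n. mixed_partial (2 * n + 3 - 1 - (2 * m + 1)) (2 * m + 1) J (x, 0))"
        unfolding f0 sum_odd_part(2)[of "\<lambda>j. mixed_partial (2 * n + 3 - 1 - j) j J (x, 0)" n] by simp
      also have "\<dots> = - (\<Sum>m=0..n. mixed_partial (2 * (n - m) + 1) (2 * m + 1) J (x, 0))"
        by (intro arg_cong[of _ _ uminus] sum.cong refl arg_cong[of _ _ "\<lambda>i. mixed_partial i _ J _"]) auto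
      finally show ?thesis by (simp add: c_def Hy_odd_term_def)
    qed
    \<comment> \<open>The series for \<open>Hy\<close> start at the second power, so the Taylor
      series is shifted by 2 before it is split by parity.\<close>
    ultimately have "(\<lambda>k. c (k + 2)) sums ((\<Sum>n. - Hy_even_term J x t n) + (\<Sum>n. - Hy_odd_term J x t n))"
      using sm[OF that] by (intro sums_even_odd) (simp_all add: numeral_eq_Suc summable_minus summable_sums)
    then have "c sums (((\<Sum>n. - Hy_even_term J x t n) + (\<Sum>n. - Hy_odd_term J x t n)) + (\<Sum>i<2. c i))"
      by (simp only: sums_iff_shift)
    \<comment> \<open>At order 0 the sums are empty; at order 1 the two summands
      \<open>j = 0\<close> do not involve the sign and cancel.\<close>
    moreover have "(\<Sum>i<2. c i) = 0"
      by (simp add: c_def f0 eval_nat_numeral)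
    ultimately show ?thesis
      using sm[OF that] by (simp add: c_def[abs_def] Hy_def suminf_minus)
  qed
  \<comment> \<open>The same Taylor series now sums both to \<open>Hy J (x, \<theta>)\<close> and to
    the integral expression, so the two are equal.\<close>
  have "(\<lambda>k. f k 0 / fact k * \<theta> ^ k) sums f 0 \<theta>"
    by (rule char_deriv_combination_sums[OF J T f_def _ \<theta>]) (use sums[of T] T in \<open>simp add: sums_iff\<close>)
  then have "Hy J (x, \<theta>) = f 0 \<theta>"
    using sums[OF \<theta>] sums_unique2 by blast
  then show ?thesis by (simp add: f_def char_deriv_def mixed_partial_0_0)
qed

lemma Ez_eq_char_integrals:
  assumes J: "real_analytic2_on J UNIV" and T: "0 < T" and \<theta>: "\<theta> \<in> {0..T}"
    and sm: "\<And>t. t \<in> {0..T} \<Longrightarrow> summable (Ez_even_term J x t) \<and> summable (Ez_odd_term J x t)"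
  shows "Ez \<eta> J (x, \<theta>) = - \<eta> * (char_integral 1 J (x, \<theta>) + char_integral (- 1) J (x, \<theta>)) / 2"
proof -
  \<comment> \<open>The factor \<open>\<eta>\<close> is left out here and restored at the
    end.\<close>
  define f where "f k t = (- 1 / 2) * char_deriv J 1 x k t + (- 1 / 2) * char_deriv J (- 1) x k t" for k t
  have f0: "f k 0 = - ((\<Sum>j<k. 1 ^ j * mixed_partial (k - 1 - j) j J (x, 0))
      + (\<Sum>j<k. (- 1) ^ j * mixed_partial (k - 1 - j) j J (x, 0))) / 2" for k
    unfolding f_def char_deriv_0 by simp
  have sums: "(\<lambda>k. f k 0 / fact k * t ^ k) sums (- (\<Sum>n. Ez_even_term J x t n) - (\<Sum>n. Ez_odd_term J x t n))"
    if "t \<in> {0..T}" for t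
  proof -
    define c where "c k = f k 0 / fact k * t ^ k" for k
    have "c (2 * n + 1) = - Ez_odd_term J x t n" for n
    proof -
      have "f (2 * n + 1) 0 = - (\<Sum>m=0..n. mixed_partial (2 * n + 1 - 1 - 2 * m) (2 * m) J (x, 0))"
        unfolding f0 sum_even_part(1)[of "\<lambda>j. mixed_partial (2 * n + 1 - 1 - j) j J (x, 0)" n] by simp
      also have "\<dots> = - (\<Sum>m=0..n. mixed_partial (2 * (n - m)) (2 * m) J (x, 0))"
        by (simp add: right_diff_distrib')
      finally show ?thesis by (simp add: c_def Ez_odd_term_def)
    qed
    moreover have "c (2 * n + 2) = - Ez_even_term J x t n" for n
    proof -
      have "f (2 * n + 2) 0 = - (\<Sum>m=0..n. mixed_partial (2 * n + 2 - 1 - 2 * m) (2 * m) J (x, 0))"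
        unfolding f0 sum_even_part(2)[of "\<lambda>j. mixed_partial (2 * n + 2 - 1 - j) j J (x, 0)" n] by simp
      also have "\<dots> = - (\<Sum>m=0..n. mixed_partial (2 * (n - m) + 1) (2 * m) J (x, 0))"
        by (intro arg_cong[of _ _ uminus] sum.cong refl arg_cong[of _ _ "\<lambda>i. mixed_partial i _ J _"]) auto
      finally show ?thesis by (simp add: c_def Ez_even_term_def)
    qed
    \<comment> \<open>The series for \<open>Ez\<close> start at the first power; after the shift by
      1 the odd powers sit at the even positions and therefore come first.\<close>
    ultimately have "(\<lambda>k. c (k + 1)) sums ((\<Sum>n. - Ez_odd_term J x t n) + (\<Sum>n. - Ez_even_term J x t n))"
      using sm[OF that] by (intro sums_even_odd) (simp_all add: numeral_eq_Suc summable_minus summable_sums)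
    then have "c sums (((\<Sum>n. - Ez_odd_term J x t n) + (\<Sum>n. - Ez_even_term J x t n)) + (\<Sum>i<1. c i))"
      by (simp add: sums_Suc_iff)
    moreover have "(\<Sum>i<1. c i) = 0"
      by (simp add: c_def f0)
    ultimately show ?thesis
      using sm[OF that] by (simp add: c_def[abs_def] suminf_minus minus_diff_commute)
  qed
  have "(\<lambda>k. f k 0 / fact k * \<theta> ^ k) sums f 0 \<theta>"
    by (rule char_deriv_combination_sums[OF J T f_def _ \<theta>]) (use sums[of T] T in \<open>simp add: sums_iff\<close>)
  then have "- (\<Sum>n. Ez_even_term J x \<theta> n) - (\<Sum>n. Ez_odd_term J x \<theta> n) = f 0 \<theta>"
    using sums[OF \<theta>] sums_unique2 by blast
  moreover have "Ez \<eta> J (x, \<theta>) = \<eta> * (- (\<Sum>n. Ez_even_term J x \<theta> n) - (\<Sum>n. Ez_odd_term J x \<theta> n))"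
    by (simp add: Ez_def algebra_simps)
  moreover have "f 0 \<theta> = - (char_integral 1 J (x, \<theta>) + char_integral (- 1) J (x, \<theta>)) / 2"
    by (simp add: f_def char_deriv_def mixed_partial_0_0)
  ultimately have "Ez \<eta> J (x, \<theta>) = \<eta> * (- (char_integral 1 J (x, \<theta>) + char_integral (- 1) J (x, \<theta>)) / 2)"
    by (simp only:)
  then show ?thesis by (simp add: algebra_simps)
qed

section \<open>Verification of the Maxwell equations\<close>

theorem theorem2:
  fixes \<epsilon> \<mu> \<eta> xmax \<theta>max :: real
    and J :: "real \<times> real \<Rightarrow> real"
  assumes "\<epsilon> > 0" and "\<mu> > 0" and "\<eta> = sqrt (\<mu> / \<epsilon>)"
    and "real_analytic2_on J UNIV"
    and "\<theta>max > 0" and "xmax > 0"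
    and "\<And>x \<theta>. \<bar>x\<bar> \<le> xmax \<Longrightarrow> 0 \<le> \<theta> \<Longrightarrow> \<theta> \<le> \<theta>max \<Longrightarrow>
           summable (Hy_even_term J x \<theta>) \<and> summable (Hy_odd_term J x \<theta>) \<and>
           summable (Ez_even_term J x \<theta>) \<and> summable (Ez_odd_term J x \<theta>)"
  shows "solves_maxwell_1d \<eta> J xmax \<theta>max (Hy J) (Ez \<eta> J)"
proof -
  have \<eta>: "\<eta> > 0" using assms by simp
  have H: "Hy J (x, \<theta>) = - (char_integral 1 J (x, \<theta>) - char_integral (- 1) J (x, \<theta>)) / 2"
    if "x \<in> {-xmax..xmax}" "\<theta> \<in> {0..\<theta>max}" for x \<theta>
    by (rule Hy_eq_char_integrals[OF assms(4,5) that(2)]) (use assms(7) that(1) in auto)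
  have E: "Ez \<eta> J (x, \<theta>) = - \<eta> * (char_integral 1 J (x, \<theta>) + char_integral (- 1) J (x, \<theta>)) / 2"
    if "x \<in> {-xmax..xmax}" "\<theta> \<in> {0..\<theta>max}" for x \<theta>
    by (rule Ez_eq_char_integrals[OF assms(4,5) that(2)]) (use assms(7) that(1) in auto)
  define W where "W \<sigma> = char_integral \<sigma> (mixed_partial 0 1 J)" for \<sigma>
  have cont: "continuous_on UNIV J" "continuous_on UNIV (mixed_partial 0 1 J)"
    using continuous_on_mixed_partial[OF assms(4), of UNIV 0 0] continuous_on_mixed_partial[OF assms(4)]
    by (simp_all only: mixed_partial_0_0)
  have Jx: "((\<lambda>x. J (x, t)) has_real_derivative mixed_partial 0 1 J (x, t)) (at x)" for x t
    using mixed_partial_deriv_fst[OF assms(4), of 0 0 t x] by (simp add: mixed_partial_0_0)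
  have Wx: "((\<lambda>x. char_integral \<sigma> J (x, \<theta>)) has_real_derivative W \<sigma> (x, \<theta>)) (at x within S)" for \<sigma> x \<theta> S
    unfolding W_def by (rule DERIV_subset[OF char_integral_deriv_fst[OF cont Jx] subset_UNIV])
  have Wt: "((\<lambda>\<theta>. char_integral \<sigma> J (x, \<theta>)) has_real_derivative J (x, \<theta>) + \<sigma> * W \<sigma> (x, \<theta>)) (at \<theta> within {0..\<theta>max})"
    if "\<theta> \<in> {0..\<theta>max}" for \<sigma> x \<theta>
    unfolding W_def by (rule char_integral_deriv_snd[OF cont Jx that])
  show ?thesis
    unfolding solves_maxwell_1d_def
  proof (intro conjI ballI)
    fix x \<theta> assume x: "x \<in> {-xmax..xmax}" and \<theta>: "\<theta> \<in> {0..\<theta>max}"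
    show "\<exists>H\<theta> Hx E\<theta> Ex.
        ((\<lambda>s. Hy J (x, s)) has_real_derivative H\<theta>) (at \<theta> within {0..\<theta>max}) \<and>
        ((\<lambda>y. Hy J (y, \<theta>)) has_real_derivative Hx) (at x within {-xmax..xmax}) \<and>
        ((\<lambda>s. Ez \<eta> J (x, s)) has_real_derivative E\<theta>) (at \<theta> within {0..\<theta>max}) \<and>
        ((\<lambda>y. Ez \<eta> J (y, \<theta>)) has_real_derivative Ex) (at x within {-xmax..xmax}) \<and>
        H\<theta> = (1 / \<eta>) * Ex \<and> E\<theta> = \<eta> * Hx - \<eta> * J (x, \<theta>)"
    proof (intro exI conjI)
      \<comment> \<open>The two time derivatives contain the same \<open>J (x, \<theta>)\<close>: it
        cancels in \<open>Hy\<close>, and in \<open>Ez\<close> it doubles and yields the source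
        term.\<close>
      have "((\<lambda>s. - (char_integral 1 J (x, s) - char_integral (- 1) J (x, s)) / 2) has_real_derivative
          - ((J (x, \<theta>) + 1 * W 1 (x, \<theta>)) - (J (x, \<theta>) + (- 1) * W (- 1) (x, \<theta>))) / 2) (at \<theta> within {0..\<theta>max})"
        by (rule DERIV_cdivide[OF DERIV_minus[OF DERIV_diff[OF Wt[OF \<theta>] Wt[OF \<theta>]]]])
      \<comment> \<open>The integral representation is known only on the rectangle. This suffices
        for derivatives taken within it, one-sided ones at the boundary included.\<close>
      then show "((\<lambda>s. Hy J (x, s)) has_real_derivative
          - ((J (x, \<theta>) + 1 * W 1 (x, \<theta>)) - (J (x, \<theta>) + (- 1) * W (- 1) (x, \<theta>))) / 2) (at \<theta> within {0..\<theta>max})"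
        by (rule has_field_derivative_transform_within[OF _ zero_less_one \<theta>]) (simp only: H[OF x])
      have "((\<lambda>y. - (char_integral 1 J (y, \<theta>) - char_integral (- 1) J (y, \<theta>)) / 2) has_real_derivative
          - (W 1 (x, \<theta>) - W (- 1) (x, \<theta>)) / 2) (at x within {-xmax..xmax})"
        by (rule DERIV_cdivide[OF DERIV_minus[OF DERIV_diff[OF Wx Wx]]])
      then show "((\<lambda>y. Hy J (y, \<theta>)) has_real_derivative - (W 1 (x, \<theta>) - W (- 1) (x, \<theta>)) / 2)
          (at x within {-xmax..xmax})"
        by (rule has_field_derivative_transform_within[OF _ zero_less_one x]) (simp only: H[OF _ \<theta>])
      have "((\<lambda>s. - \<eta> * (char_integral 1 J (x, s) + char_integral (- 1) J (x, s)) / 2) has_real_derivative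
          - \<eta> * ((J (x, \<theta>) + 1 * W 1 (x, \<theta>)) + (J (x, \<theta>) + (- 1) * W (- 1) (x, \<theta>))) / 2) (at \<theta> within {0..\<theta>max})"
        by (rule DERIV_cdivide[OF DERIV_cmult[OF DERIV_add[OF Wt[OF \<theta>] Wt[OF \<theta>]]]])
      then show "((\<lambda>s. Ez \<eta> J (x, s)) has_real_derivative
          - \<eta> * ((J (x, \<theta>) + 1 * W 1 (x, \<theta>)) + (J (x, \<theta>) + (- 1) * W (- 1) (x, \<theta>))) / 2) (at \<theta> within {0..\<theta>max})"
        by (rule has_field_derivative_transform_within[OF _ zero_less_one \<theta>]) (simp only: E[OF x])
      have "((\<lambda>y. - \<eta> * (char_integral 1 J (y, \<theta>) + char_integral (- 1) J (y, \<theta>)) / 2) has_real_derivative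
          - \<eta> * (W 1 (x, \<theta>) + W (- 1) (x, \<theta>)) / 2) (at x within {-xmax..xmax})"
        by (rule DERIV_cdivide[OF DERIV_cmult[OF DERIV_add[OF Wx Wx]]])
      then show "((\<lambda>y. Ez \<eta> J (y, \<theta>)) has_real_derivative - \<eta> * (W 1 (x, \<theta>) + W (- 1) (x, \<theta>)) / 2)
          (at x within {-xmax..xmax})"
        by (rule has_field_derivative_transform_within[OF _ zero_less_one x]) (simp only: E[OF _ \<theta>])
    qed (use \<eta> in \<open>simp_all add: field_simps\<close>)
  next
    fix x assume "x \<in> {-xmax..xmax}"
    then show "Hy J (x, 0) = 0" "Ez \<eta> J (x, 0) = 0"
      using H[of x 0] E[of x 0] assms(5) by (auto simp: char_integral_def)
  qed
qed

end
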